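(* Fix $d,s\in\mathbb{N}$, $\mathbf{k}=(k_1,\ldots,k_{d-1})\in\mathbb{N}^{d-1}$, and $m\in\mathbb{N}$. There exists $c=c(d,\mathbf{k},s,m)\in\mathbb{N}$ such that for every prime field $\mathbb{F}$, every $n$, and every $\mathcal{F}\subset\mathrm{RM}_{\mathbb{F}}(n,d-1)$ with $|\mathcal{F}|=m$, letting $\mathcal{C}=\mathrm{RM}_{\mathbb{F}}(n,d,\mathbf{k},\mathcal{F})$, the following holds: for any $\varphi:\mathbb{F}^n\to\Delta(\mathbb{F})$ there exist sets of polynomials $\mathcal{F}_i\subset\mathrm{RM}_{\mathbb{F}}(n,d-1)$, $1\le i\le|\mathbb{F}|^c$, each of size at most $c$, such that for every $f\in\mathcal{C}$ there exists $1\le i\le|\mathbb{F}|^c$ with $\left|\langle p(f),\varphi\rangle-\langle p(f),\mathbb{E}[\varphi\mid\mathcal{F}_i]\rangle\right|\le|\mathbb{F}|^{-s}$.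
   Context: $\mathrm{RM}_{\mathbb{F}}(n,d)$ is the set of polynomial functions $\mathbb{F}^n\to\mathbb{F}$ of degree at most $d$. For $\mathbf{k}\in\mathbb{N}^{d-1}$ and a finite set $\mathcal{F}$ of polynomials of degree at most $d-1$, $\mathrm{RM}_{\mathbb{F}}(n,d,\mathbf{k},\mathcal{F})$ is the set of polynomials in $\mathrm{RM}_{\mathbb{F}}(n,d)$ which can be written as a function of the polynomials in $\mathcal{F}$ together with $\sum_ik_i$ additional polynomials, $k_i$ of which have degree $i$ for $1\le i\le d-1$. $\Delta(\mathbb{F})$ is the probability simplex on $\mathbb{F}$; $p(f)(x)=e_{f(x)}$ is the unit vector at $f(x)$; $\langle\varphi,\psi\rangle=\mathbb{E}_{x\in\mathbb{F}^n}\sum_{y\in\mathbb{F}}\varphi(x)_y\psi(x)_y$; for $\mathcal{F}'=\{h_1,\ldots,h_r\}$, $\mathbb{E}[\varphi\mid\mathcal{F}'](x)$ is the average of $\varphi(y)$ over $y$ with $h_j(y)=h_j(x)$ for all $j$. *)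

theory Defs
  imports Complex_Main "HOL-Library.FuncSet" "HOL-Computational_Algebra.Primes"
begin

(* The prime field with p elements is represented by the residues 0, ..., p - 1, with arithmetic
   modulo p. It is a set of integers rather than a type because the constant in the main statement
   has to be chosen before the field. Points of the n-dimensional space and functions on that space
   are extensional, so that equality is equality of functions and the cardinality of a set of
   functions is the intended one. *)

definition GFp :: "nat \<Rightarrow> int set" where
  "GFp p = {0..<int p}"

definition points :: "nat \<Rightarrow> nat \<Rightarrow> (nat \<Rightarrow> int) set" where
  "points p n = {..<n} \<rightarrow>\<^sub>E GFp p"

type_synonym pfun = "(nat \<Rightarrow> int) \<Rightarrow> int"

definition exponents :: "nat \<Rightarrow> nat \<Rightarrow> (nat \<Rightarrow> nat) set" where
  "exponents n d = {e \<in> {..<n} \<rightarrow>\<^sub>E {..d}. (\<Sum>i<n. e i) \<le> d}"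

definition poly_eval :: "nat \<Rightarrow> nat \<Rightarrow> nat \<Rightarrow> ((nat \<Rightarrow> nat) \<Rightarrow> int) \<Rightarrow> (nat \<Rightarrow> int) \<Rightarrow> int" where
  "poly_eval p n d a x = (\<Sum>e\<in>exponents n d. a e * (\<Prod>i<n. x i ^ e i)) mod int p"

definition RM :: "nat \<Rightarrow> nat \<Rightarrow> nat \<Rightarrow> pfun set" where
  "RM p n d = {f \<in> points p n \<rightarrow>\<^sub>E GFp p. \<exists>a. \<forall>x\<in>points p n. f x = poly_eval p n d a x}"

(* The degree of a polynomial function is the least degree of a polynomial that represents it. *)
definition pdegree :: "nat \<Rightarrow> nat \<Rightarrow> pfun \<Rightarrow> nat" where
  "pdegree p n f = (LEAST e. f \<in> RM p n e)"

(* The additional polynomials are g i j with 1 \<le> i \<le> d - 1 and j < k i, where g i j has degree i;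
   only the values k 1, ..., k (d - 1) are used. Repetitions among the g i j are allowed.
   The restrictions ensure that \<Gamma> sees only the values at x of the polynomials in Fs and of
   these g i j. *)
definition RM_struct :: "nat \<Rightarrow> nat \<Rightarrow> nat \<Rightarrow> (nat \<Rightarrow> nat) \<Rightarrow> pfun set \<Rightarrow> pfun set" where
  "RM_struct p n d k Fs =
    {f \<in> RM p n d. \<exists>(g :: nat \<Rightarrow> nat \<Rightarrow> pfun) (\<Gamma> :: (pfun \<Rightarrow> int) \<Rightarrow> (nat \<Rightarrow> nat \<Rightarrow> int) \<Rightarrow> int).
       (\<forall>i\<in>{1..d - 1}. \<forall>j<k i. g i j \<in> RM p n i \<and> pdegree p n (g i j) = i) \<and>
       (\<forall>x\<in>points p n.
          f x = \<Gamma> (\<lambda>h\<in>Fs. h x) (\<lambda>i\<in>{1..d - 1}. \<lambda>j\<in>{..<k i}. g i j x))}"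

definition prob_simplex :: "nat \<Rightarrow> (int \<Rightarrow> real) set" where
  "prob_simplex p = {v. (\<forall>y\<in>GFp p. 0 \<le> v y) \<and> (\<Sum>y\<in>GFp p. v y) = 1}"

definition unit_at :: "pfun \<Rightarrow> (nat \<Rightarrow> int) \<Rightarrow> int \<Rightarrow> real" where
  "unit_at f x y = (if y = f x then 1 else 0)"

definition avg_inner ::
    "nat \<Rightarrow> nat \<Rightarrow> ((nat \<Rightarrow> int) \<Rightarrow> int \<Rightarrow> real) \<Rightarrow> ((nat \<Rightarrow> int) \<Rightarrow> int \<Rightarrow> real) \<Rightarrow> real" where
  "avg_inner p n \<phi> \<psi> =
    (\<Sum>x\<in>points p n. \<Sum>y\<in>GFp p. \<phi> x y * \<psi> x y) / real (card (points p n))"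

definition atom :: "nat \<Rightarrow> nat \<Rightarrow> pfun set \<Rightarrow> (nat \<Rightarrow> int) \<Rightarrow> (nat \<Rightarrow> int) set" where
  "atom p n H x = {z \<in> points p n. \<forall>h\<in>H. h z = h x}"

definition cond_avg ::
    "nat \<Rightarrow> nat \<Rightarrow> ((nat \<Rightarrow> int) \<Rightarrow> int \<Rightarrow> real) \<Rightarrow> pfun set \<Rightarrow> (nat \<Rightarrow> int) \<Rightarrow> int \<Rightarrow> real" where
  "cond_avg p n \<phi> H x y = (\<Sum>z\<in>atom p n H x. \<phi> z y) / real (card (atom p n H x))"

(* Since RM is finite, card below is never the default value 0 of an infinite set. *)
lemma finite_RM: "finite (RM p n d)"
proof -
  have "finite (points p n \<rightarrow>\<^sub>E GFp p)"
    by (auto intro!: finite_PiE simp: points_def GFp_def)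
  then show ?thesis
    by (rule rev_finite_subset) (auto simp: RM_def)
qed

end

theory Submission
  imports Defs "HOL-Analysis.Convex" "HOL-Library.Multiset" "HOL-Library.Real_Mod"
begin

text \<open>
  Let f be a function of the polynomials in a set S and of some further polynomials, and suppose that
  S itself does not serve as the approximating family of f. By Fourier expansion, some nontrivial
  linear combination P of the further polynomials has character sum at least p to the minus r against
  a bounded function which depends only on \<phi>, S, a value y and an atom of S. By almost orthogonality
  there is a list of polynomially many (in p) polynomials, independent of f, such that P - Q is biased
  for some Q in the list. By an argument of Bogdanov and Viola, a biased polynomial agrees, outside a
  set of small density, with a function of boundedly many polynomials of lower degree. Hence f agrees
  outside this set with a function f' of S, of Q and of the further polynomials, where one of those of
  leading degree is traded for boundedly many of lower degree. The multiset of degrees decreases in the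
  multiset order, so the process stops after boundedly many steps, each of which has only polynomially
  many outcomes.
\<close>

text \<open>The constant must be fixed before p, n and \<phi>, so whatever is guessed on the way has
  to come from a set of polynomial size in p that does not depend on f. The polynomials that define
  f are no such guess. The scheme works because they are never named: guessed are only the value y,
  the atom, the degree traded, the number of polynomials gained, and a member Q of the list. Q joins
  S, which thus grows by one polynomial per step, while the polynomials of lower degree remain
  unknown and are merely counted. Their number must be bounded independently of p and n, which is
  why derivatives enter through their few Taylor coefficients and not separately for each of the p
  multiples of a direction. The traded function f' is in general not a polynomial, so the induction
  concerns arbitrary functions determined by S and by polynomials of prescribed degrees. Passing
  from f to f' costs accuracy, hence the next step is asked for the error exponent s + 1 instead of
  s.\<close>

subsection \<open>Polynomial functions\<close>

text \<open>Integer polynomials of degree at most e in n variables, presented without coefficients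
  so that closure properties and Taylor expansion follow by rule induction. Reduction modulo p is
  left to \<open>RM_iff\<close>.\<close>

inductive polyfun :: "nat \<Rightarrow> nat \<Rightarrow> ((nat \<Rightarrow> int) \<Rightarrow> int) \<Rightarrow> bool" for n where
  polyfun_const: "polyfun n e (\<lambda>x. c)"
| polyfun_add: "polyfun n e f \<Longrightarrow> polyfun n e g \<Longrightarrow> polyfun n e (\<lambda>x. f x + g x)"
| polyfun_mult_var: "i < n \<Longrightarrow> polyfun n e f \<Longrightarrow> polyfun n (Suc e) (\<lambda>x. x i * f x)"

lemma polyfun_Suc: "polyfun n e f \<Longrightarrow> polyfun n (Suc e) f"
  by (induction rule: polyfun.induct) (auto intro: polyfun.intros)

lemma polyfun_mono: "e \<le> e' \<Longrightarrow> polyfun n e f \<Longrightarrow> polyfun n e' f"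
  by (induction e' rule: dec_induct) (auto intro: polyfun_Suc)

lemma polyfun_cmult: "polyfun n e f \<Longrightarrow> polyfun n e (\<lambda>x. c * f x)"
proof (induction rule: polyfun.induct)
  case (polyfun_mult_var i e f)
  then show ?case
    using polyfun.polyfun_mult_var[of i n e "\<lambda>x. c * f x"] by (simp add: mult.left_commute)
qed (auto intro: polyfun.intros simp: distrib_left)

lemma polyfun_sum: "(\<And>j. j \<in> J \<Longrightarrow> polyfun n e (f j)) \<Longrightarrow> polyfun n e (\<lambda>x. \<Sum>j\<in>J. f j x)"
  by (induction J rule: infinite_finite_induct) (auto intro: polyfun.intros)

lemma polyfun_mult_power: "i < n \<Longrightarrow> polyfun n e f \<Longrightarrow> polyfun n (k + e) (\<lambda>x. x i ^ k * f x)"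
proof (induction k)
  case (Suc k)
  then show ?case
    using polyfun_mult_var[of i n "k + e" "\<lambda>x. x i ^ k * f x"] by (simp add: mult.assoc)
qed simp

lemma polyfun_monomial:
  assumes "I \<subseteq> {..<n}"
  shows "polyfun n (\<Sum>i\<in>I. e i) (\<lambda>x. \<Prod>i\<in>I. x i ^ e i)"
proof -
  have "finite I" using assms finite_subset by blast
  then show ?thesis using assms
  proof (induction I rule: finite_induct)
    case empty
    show ?case by (simp add: polyfun_const)
  next
    case (insert i I)
    then show ?case
      using polyfun_mult_power[of i n "sum e I" "\<lambda>x. \<Prod>i\<in>I. x i ^ e i" "e i"] by simp
  qed
qed

lemma finite_exponents: "finite (exponents n d)"
proof -
  have "finite ({..<n} \<rightarrow>\<^sub>E {..d})" by (auto intro: finite_PiE)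
  then show ?thesis by (rule rev_finite_subset) (auto simp: exponents_def)
qed

lemma polyfun_coefficients:
  "polyfun n d f \<Longrightarrow> \<exists>a. \<forall>x. f x = (\<Sum>e\<in>exponents n d. a e * (\<Prod>i<n. x i ^ e i))"
proof (induction rule: polyfun.induct)
  case (polyfun_const d c)
  let ?z = "\<lambda>i\<in>{..<n}. 0::nat"
  have z: "?z \<in> exponents n d" by (auto simp: exponents_def)
  have "c = (\<Sum>e\<in>exponents n d. (if e = ?z then c else 0) * (\<Prod>i<n. x i ^ e i))" for x :: "nat \<Rightarrow> int"
  proof -
    have "(\<Sum>e\<in>exponents n d. (if e = ?z then c else 0) * (\<Prod>i<n. x i ^ e i))
      = (\<Sum>e\<in>exponents n d. if e = ?z then c else 0)"
      by (intro sum.cong) auto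
    also have "\<dots> = c" using z finite_exponents[of n d] by (simp add: sum.delta)
    finally show ?thesis by simp
  qed
  then show ?case by (intro exI[of _ "\<lambda>e. if e = ?z then c else 0"]) blast
next
  case (polyfun_add d f g)
  then obtain a b where "\<forall>x. f x = (\<Sum>e\<in>exponents n d. a e * (\<Prod>i<n. x i ^ e i))"
    "\<forall>x. g x = (\<Sum>e\<in>exponents n d. b e * (\<Prod>i<n. x i ^ e i))" by auto
  then show ?case
    by (intro exI[of _ "\<lambda>e. a e + b e"]) (simp add: distrib_right sum.distrib)
next
  case (polyfun_mult_var i d f)
  then obtain a where a: "\<forall>x. f x = (\<Sum>e\<in>exponents n d. a e * (\<Prod>i<n. x i ^ e i))" by auto
  let ?up = "\<lambda>e. e(i := Suc (e i))"
  let ?b = "\<lambda>e. if e i = 0 then 0 else a (e(i := e i - 1))"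
  \<comment> \<open>The bound on single exponents follows from the bound on their sum, so
    \<open>up\<close> and \<open>down\<close> only have to control the sum and
    extensionality.\<close>
  have exponents_iff: "e \<in> exponents n d \<longleftrightarrow> e \<in> extensional {..<n} \<and> (\<Sum>j<n. e j) \<le> d" for e d
  proof -
    have "e j \<le> (\<Sum>j<n. e j)" if "j < n" for j
      using member_le_sum[of j "{..<n}" e] that by simp
    then show ?thesis unfolding exponents_def PiE_iff using le_trans by blast
  qed
  have up: "?up e \<in> exponents n (Suc d)" if "e \<in> exponents n d" for e
  proof -
    have "(\<Sum>j<n. (?up e) j) = Suc (\<Sum>j<n. e j)"
      using polyfun_mult_var(1) by (simp add: sum.remove[of "{..<n}" i])
    moreover have "?up e \<in> extensional {..<n}"
      using that polyfun_mult_var(1) by (simp add: exponents_iff extensional_def)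
    ultimately show ?thesis using that by (simp add: exponents_iff)
  qed
  have down: "e(i := e i - 1) \<in> exponents n d" if e: "e \<in> exponents n (Suc d)" "e i \<noteq> 0" for e
  proof -
    let ?e = "e(i := e i - 1)"
    have "(\<Sum>j<n. e j) = Suc (\<Sum>j<n. ?e j)"
      using polyfun_mult_var(1) e by (simp add: sum.remove[of "{..<n}" i])
    moreover have "?e \<in> extensional {..<n}"
      using e(1) polyfun_mult_var(1) by (simp add: exponents_iff extensional_def)
    ultimately show ?thesis using e by (simp add: exponents_iff)
  qed
  have "x i * f x = (\<Sum>e\<in>exponents n (Suc d). ?b e * (\<Prod>j<n. x j ^ e j))" for x
  proof -
    have "(\<Sum>e\<in>exponents n (Suc d). ?b e * (\<Prod>j<n. x j ^ e j))
        = (\<Sum>e\<in>{e \<in> exponents n (Suc d). e i \<noteq> 0}. a (e(i := e i - 1)) * (\<Prod>j<n. x j ^ e j))"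
      by (rule sum.mono_neutral_cong_right) (auto simp: finite_exponents)
    also have "\<dots> = (\<Sum>e\<in>exponents n d. a e * (x i * (\<Prod>j<n. x j ^ e j)))"
    proof (rule sum.reindex_bij_witness[of _ ?up "\<lambda>e. e(i := e i - 1)"])
      fix e assume e: "e \<in> {e \<in> exponents n (Suc d). e i \<noteq> 0}"
      let ?e = "e(i := e i - 1)"
      have "(\<Prod>j<n. x j ^ e j) = x i * (\<Prod>j<n. x j ^ ?e j)"
      proof -
        obtain l where "e i = Suc l" using e by (cases "e i") auto
        then show ?thesis using polyfun_mult_var(1) by (simp add: prod.remove[of "{..<n}" i])
      qed
      then show "a ?e * (x i * (\<Prod>j<n. x j ^ ?e j)) = a ?e * (\<Prod>j<n. x j ^ e j)" by simp
    next
      fix e assume e: "e \<in> {e \<in> exponents n (Suc d). e i \<noteq> 0}"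
      then show "e(i := e i - 1) \<in> exponents n d" using down[of e] by simp
      show "?up (e(i := e i - 1)) = e" using e by simp
    next
      fix e assume "e \<in> exponents n d"
      then show "?up e \<in> {e \<in> exponents n (Suc d). e i \<noteq> 0}" using up[of e] by simp
      show "(?up e)(i := (?up e) i - 1) = e" by simp
    qed
    also have "\<dots> = x i * f x" using a by (simp add: sum_distrib_left mult.left_commute)
    finally show ?thesis by simp
  qed
  then show ?case by (intro exI[of _ ?b]) blast
qed

lemma RM_iff:
  "f \<in> RM p n e \<longleftrightarrow>
    f \<in> points p n \<rightarrow>\<^sub>E GFp p \<and> (\<exists>g. polyfun n e g \<and> (\<forall>x\<in>points p n. f x = g x mod int p))"
proof
  assume f: "f \<in> RM p n e"
  then obtain a where a: "\<forall>x\<in>points p n. f x = poly_eval p n e a x" by (auto simp: RM_def)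
  let ?g = "\<lambda>x. \<Sum>E\<in>exponents n e. a E * (\<Prod>i<n. x i ^ E i)"
  have "polyfun n e ?g"
  proof (intro polyfun_sum polyfun_cmult)
    fix E assume "E \<in> exponents n e"
    then have "(\<Sum>i<n. E i) \<le> e" by (simp add: exponents_def)
    then show "polyfun n e (\<lambda>x. \<Prod>i<n. x i ^ E i)"
      using polyfun_monomial[of "{..<n}" n E] polyfun_mono by blast
  qed
  then show "f \<in> points p n \<rightarrow>\<^sub>E GFp p \<and> (\<exists>g. polyfun n e g \<and> (\<forall>x\<in>points p n. f x = g x mod int p))"
    using f a by (auto simp: RM_def poly_eval_def)
next
  assume "f \<in> points p n \<rightarrow>\<^sub>E GFp p \<and> (\<exists>g. polyfun n e g \<and> (\<forall>x\<in>points p n. f x = g x mod int p))"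
  then show "f \<in> RM p n e"
    using polyfun_coefficients by (fastforce simp: RM_def poly_eval_def)
qed

lemma RM_I:
  assumes "polyfun n e g" "p > 0"
  shows "(\<lambda>x\<in>points p n. g x mod int p) \<in> RM p n e"
  unfolding RM_iff using assms by (intro conjI exI[of _ g]) (auto simp: GFp_def)

lemma RM_mono: "e \<le> e' \<Longrightarrow> RM p n e \<subseteq> RM p n e'"
  unfolding RM_iff subset_iff using polyfun_mono by blast

lemma RM_degree_0:
  assumes "f \<in> RM p n 0" "x \<in> points p n" "z \<in> points p n"
  shows "f x = f z"
proof -
  have const: "e = 0 \<Longrightarrow> g x = g z" if "polyfun n e g" for e g
    using that by (induction rule: polyfun.induct) auto
  obtain g where "polyfun n 0 g" "\<forall>x\<in>points p n. f x = g x mod int p"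
    using assms(1) by (auto simp: RM_iff)
  then show ?thesis using assms const[of 0 g] by simp
qed

text \<open>Terms whose coefficient vanishes modulo p may have any degree. Thus a combination of
  polynomials of mixed degrees inherits the largest degree that survives in it.\<close>

lemma RM_linear_combination:
  assumes "\<And>g. g \<in> T \<Longrightarrow> \<not> int p dvd b g \<Longrightarrow> g \<in> RM p n e" "p > 0"
  shows "(\<lambda>x\<in>points p n. (\<Sum>g\<in>T. b g * g x) mod int p) \<in> RM p n e"
proof -
  have "\<exists>q. polyfun n e q \<and> (\<forall>x\<in>points p n. b g * g x mod int p = q x mod int p)" if g: "g \<in> T" for g
  proof (cases "int p dvd b g")
    case True
    then show ?thesis by (intro exI[of _ "\<lambda>_. 0"]) (auto intro: polyfun_const)
  next
    case False
    then obtain q where "polyfun n e q" "\<forall>x\<in>points p n. g x = q x mod int p"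
      using assms(1)[OF g] by (auto simp: RM_iff)
    then show ?thesis
      by (intro exI[of _ "\<lambda>x. b g * q x"]) (auto intro: polyfun_cmult simp: mod_mult_right_eq)
  qed
  then obtain q where q: "\<And>g. g \<in> T \<Longrightarrow> polyfun n e (q g)"
    "\<And>g x. g \<in> T \<Longrightarrow> x \<in> points p n \<Longrightarrow> b g * g x mod int p = q g x mod int p" by metis
  have "(\<Sum>g\<in>T. b g * g x) mod int p = (\<Sum>g\<in>T. q g x) mod int p" if "x \<in> points p n" for x
    using mod_sum_eq[of "\<lambda>g. b g * g x" "int p" T] mod_sum_eq[of "\<lambda>g. q g x" "int p" T] q(2) that
    by simp
  then have "(\<lambda>x\<in>points p n. (\<Sum>g\<in>T. b g * g x) mod int p) 
      = (\<lambda>x\<in>points p n. (\<Sum>g\<in>T. q g x) mod int p)"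
    by (rule restrict_ext)
  moreover have "polyfun n e (\<lambda>x. \<Sum>g\<in>T. q g x)" using q(1) by (rule polyfun_sum)
  ultimately show ?thesis using RM_I assms(2) by presburger
qed

lemma RM_diff:
  assumes "f \<in> RM p n e" "g \<in> RM p n e" "p > 0"
  shows "(\<lambda>x\<in>points p n. (f x - g x) mod int p) \<in> RM p n e"
proof -
  obtain q q' where q: "polyfun n e q" "polyfun n e q'" "\<forall>x\<in>points p n. f x = q x mod int p"
    "\<forall>x\<in>points p n. g x = q' x mod int p" using assms by (auto simp: RM_iff)
  have "polyfun n e (\<lambda>x. q x + (-1) * q' x)" using q by (intro polyfun_add polyfun_cmult)
  moreover have "(\<lambda>x\<in>points p n. (f x - g x) mod int p) = (\<lambda>x\<in>points p n. (q x + (-1) * q' x) mod int p)"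
    using q(3,4) by (intro restrict_ext) (simp add: mod_diff_eq)
  ultimately show ?thesis using RM_I[OF _ assms(3)] by simp
qed

lemma RM_range: "f \<in> RM p n e \<Longrightarrow> x \<in> points p n \<Longrightarrow> f x \<in> GFp p"
  by (auto simp: RM_def)

section \<open>Taylor expansion along lines modulo p\<close>

definition shift :: "nat \<Rightarrow> nat \<Rightarrow> (nat \<Rightarrow> int) \<Rightarrow> int \<Rightarrow> (nat \<Rightarrow> int) \<Rightarrow> nat \<Rightarrow> int" where
  "shift p n x a y = (\<lambda>i\<in>{..<n}. (x i + a * y i) mod int p)"

lemma shift_in_points: "p > 0 \<Longrightarrow> shift p n x a y \<in> points p n"
  by (auto simp: shift_def points_def GFp_def)

lemma polyfun_mod_cong:
  "polyfun n e f \<Longrightarrow> (\<And>i. i < n \<Longrightarrow> x i mod q = z i mod q) \<Longrightarrow> f x mod q = f z mod (q::int)"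
  by (induction rule: polyfun.induct) (auto intro: mod_add_cong mod_mult_cong)

text \<open>The direction y is fixed and f (x + a y) is expanded in powers of a; no factorials are
  divided by, so small primes need no care. Since \<open>h 0 = f\<close>, the increment from x to x
  + a y starts at j = 1 and involves only polynomials of lower degree.\<close>

lemma polyfun_taylor:
  "polyfun n e f \<Longrightarrow> \<exists>h. h 0 = f \<and> (\<forall>j\<le>e. polyfun n (e - j) (h j)) \<and>
     (\<forall>x a. f (\<lambda>i. x i + a * y i) = (\<Sum>j\<le>e. a ^ j * h j x))"
proof (induction rule: polyfun.induct)
  case (polyfun_const e c)
  show ?case
  proof (intro exI[of _ "\<lambda>j x. if j = 0 then c else 0"] conjI allI impI)
    fix a :: int and x :: "nat \<Rightarrow> int"
    have "(\<Sum>j\<le>e. a ^ j * (if j = 0 then c else 0)) = (\<Sum>j\<le>e. if j = 0 then c else 0)"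
      by (rule sum.cong) auto
    then show "c = (\<Sum>j\<le>e. a ^ j * (if j = 0 then c else 0))" by simp
  qed (auto intro: polyfun.intros)
next
  case (polyfun_add e f g)
  then obtain h k where "h 0 = f" "\<forall>j\<le>e. polyfun n (e - j) (h j)"
     "\<forall>x a. f (\<lambda>i. x i + a * y i) = (\<Sum>j\<le>e. a ^ j * h j x)" 
     "k 0 = g" "\<forall>j\<le>e. polyfun n (e - j) (k j)"
     "\<forall>x a. g (\<lambda>i. x i + a * y i) = (\<Sum>j\<le>e. a ^ j * k j x)" by auto
  then show ?case
    by (intro exI[of _ "\<lambda>j x. h j x + k j x"])
      (auto simp: distrib_left sum.distrib intro: polyfun.polyfun_add)
next
  case (polyfun_mult_var i e f)
  then obtain h where h: "h 0 = f" "\<And>j. j \<le> e \<Longrightarrow> polyfun n (e - j) (h j)"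
     "\<And>x a. f (\<lambda>i. x i + a * y i) = (\<Sum>j\<le>e. a ^ j * h j x)" by auto
  \<comment> \<open>The coefficient of a^j in the product of x_i + a y_i and f (x + a y). The guard
    is there because \<open>h j\<close> is unspecified for j > e.\<close>
  let ?k = "\<lambda>j x. (if j \<le> e then x i * h j x else 0) + (if j = 0 then 0 else y i * h (j - 1) x)"
  show ?case
  proof (intro exI[of _ ?k] conjI allI impI)
    show "?k 0 = (\<lambda>x. x i * f x)" using h(1) by simp
    fix j assume j: "j \<le> Suc e"
    have "polyfun n (Suc e - j) (\<lambda>x. if j \<le> e then x i * h j x else 0)"
    proof (cases "j \<le> e")
      case True
      then show ?thesis using polyfun.polyfun_mult_var[OF polyfun_mult_var(1) h(2)[OF True]]
        by (simp add: Suc_diff_le)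
    qed (auto intro: polyfun_const)
    moreover have "polyfun n (Suc e - j) (\<lambda>x. if j = 0 then 0 else y i * h (j - 1) x)"
    proof (cases j)
      case (Suc l)
      then show ?thesis using h(2)[of l] j by (simp add: polyfun_cmult)
    qed (auto intro: polyfun_const)
    ultimately show "polyfun n (Suc e - j) (?k j)" by (rule polyfun_add)
  next
    fix x a
    have "(\<Sum>j\<le>Suc e. a ^ j * ?k j x) = (\<Sum>j\<le>Suc e. a ^ j * (if j \<le> e then x i * h j x else 0))
      + (\<Sum>j\<le>Suc e. a ^ j * (if j = 0 then 0 else y i * h (j - 1) x))"
      by (simp only: distrib_left sum.distrib)
    also have "(\<Sum>j\<le>Suc e. a ^ j * (if j \<le> e then x i * h j x else 0)) = x i * (\<Sum>j\<le>e. a ^ j * h j x)"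
      by (simp add: sum_distrib_left mult.left_commute)
    also have "(\<Sum>j\<le>Suc e. a ^ j * (if j = 0 then 0 else y i * h (j - 1) x)) 
        = a * y i * (\<Sum>j\<le>e. a ^ j * h j x)"
      by (subst sum.atMost_Suc_shift) (simp add: sum_distrib_left algebra_simps)
    finally show "(x i + a * y i) * f (\<lambda>i. x i + a * y i) = (\<Sum>j\<le>Suc e. a ^ j * ?k j x)"
      using h(3) by (simp add: distrib_right)
  qed
qed

definition agree :: "pfun set \<Rightarrow> (nat \<Rightarrow> int) \<Rightarrow> (nat \<Rightarrow> int) \<Rightarrow> bool" where
  "agree H x z \<longleftrightarrow> (\<forall>h\<in>H. h x = h z)"

text \<open>The e Taylor coefficients of positive order serve all multiples a of the direction at
  once. Using the increments themselves would require a polynomial for each a, and the count would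
  depend on p.\<close>

lemma RM_taylor:
  assumes f: "f \<in> RM p n e" and p: "p > 0"
  obtains A where "A \<subseteq> RM p n (e - 1)" "card A \<le> e"
    "\<And>x z a. x \<in> points p n \<Longrightarrow> z \<in> points p n \<Longrightarrow> agree A x z \<Longrightarrow>
       (f (shift p n x a y) - f x) mod int p = (f (shift p n z a y) - f z) mod int p"
proof -
  obtain g where g: "polyfun n e g" "\<And>x. x \<in> points p n \<Longrightarrow> f x = g x mod int p"
    using f by (auto simp: RM_iff)
  obtain h where h: "h 0 = g" "\<And>j. j \<le> e \<Longrightarrow> polyfun n (e - j) (h j)"
     "\<And>x a. g (\<lambda>i. x i + a * y i) = (\<Sum>j\<le>e. a ^ j * h j x)"
    using polyfun_taylor[OF g(1)] by metis
  define k where "k j = (\<lambda>x\<in>points p n. h j x mod int p)" for j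
  have k: "k j \<in> RM p n (e - 1)" if "j \<in> {1..e}" for j
  proof -
    have "polyfun n (e - 1) (h j)" using h(2)[of j] that polyfun_mono[of "e - j" "e - 1" n "h j"] by auto
    then show ?thesis unfolding k_def using p by (rule RM_I)
  qed
  have diff: "(f (shift p n x a y) - f x) mod int p = (\<Sum>j=1..e. a ^ j * k j x) mod int p"
    if x: "x \<in> points p n" for x a
  proof -
    have "f (shift p n x a y) = g (\<lambda>i. x i + a * y i) mod int p"
      using g(2)[OF shift_in_points[OF p]] polyfun_mod_cong[OF g(1), of "shift p n x a y" "int p" "\<lambda>i. x i + a * y i"]
      by (simp add: shift_def)
    then have "(f (shift p n x a y) - f x) mod int p = (g (\<lambda>i. x i + a * y i) - g x) mod int p"
      using g(2)[OF x] by (simp add: mod_diff_eq)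
    also have "g (\<lambda>i. x i + a * y i) - g x = (\<Sum>j=1..e. a ^ j * h j x)"
    proof -
      have "{..e} = insert 0 {1..e}" by auto
      then show ?thesis using h(1,3) by simp
    qed
    also have "\<dots> mod int p = (\<Sum>j=1..e. a ^ j * k j x) mod int p"
    proof -
      have "a ^ j * h j x mod int p = a ^ j * k j x mod int p" for j
        using x by (simp add: k_def mod_mult_right_eq)
      then show ?thesis
        using mod_sum_eq[of "\<lambda>j. a ^ j * h j x" "int p" "{1..e}"]
          mod_sum_eq[of "\<lambda>j. a ^ j * k j x" "int p" "{1..e}"] by simp
    qed
    finally show ?thesis .
  qed
  show ?thesis
  proof (rule that[of "k ` {1..e}"])
    show "k ` {1..e} \<subseteq> RM p n (e - 1)" using k by auto
    show "card (k ` {1..e}) \<le> e" using card_image_le[of "{1..e}" k] by simp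
  next
    fix x z a assume "x \<in> points p n" "z \<in> points p n" "agree (k ` {1..e}) x z"
    then show "(f (shift p n x a y) - f x) mod int p = (f (shift p n z a y) - f z) mod int p"
      by (simp add: diff agree_def)
  qed
qed

subsection \<open>Additive characters\<close>

lemma finite_GFp: "finite (GFp p)"
  by (simp add: GFp_def)

lemma card_GFp: "card (GFp p) = p"
  by (simp add: GFp_def)

lemma finite_points: "finite (points p n)"
  unfolding points_def by (intro finite_PiE) (simp_all add: finite_GFp)

lemma card_points: "card (points p n) = p ^ n"
  unfolding points_def by (subst card_PiE) (simp_all add: card_GFp)

definition character :: "nat \<Rightarrow> int \<Rightarrow> complex" where
  "character p t = cis (2 * pi * real_of_int t / real p)"

lemma norm_character [simp]: "cmod (character p t) = 1"
  by (simp add: character_def)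

lemma character_0 [simp]: "character p 0 = 1"
  by (simp add: character_def)

lemma character_add: "character p (s + t) = character p s * character p t"
  by (simp add: character_def cis_mult distrib_left add_divide_distrib)

lemma character_minus: "character p (- t) = cnj (character p t)"
  by (simp add: character_def cis_cnj)

lemma character_diff: "character p (s - t) = character p s * cnj (character p t)"
  using character_add[of p s "- t"] by (simp add: character_minus)

lemma character_mult_cnj [simp]: "character p t * cnj (character p t) = 1"
  using character_diff[of p t t] by simp

lemma character_multiple: "p > 0 \<Longrightarrow> character p (int p * t) = 1"
  using cis_multiple_2pi[of "real_of_int t"] by (simp add: character_def mult.assoc)

lemma character_mod: "p > 0 \<Longrightarrow> character p (t mod int p) = character p t"
  using character_add[of p "int p * (t div int p)" "t mod int p"]
  by (simp only: character_multiple mult_div_mod_eq mult_1)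

lemma character_power: "character p t ^ j = character p (int j * t)"
  by (induction j) (simp_all add: distrib_right character_add)

lemma character_neq_1:
  assumes "p > 0" "\<not> int p dvd t"
  shows "character p t \<noteq> 1"
proof
  assume "character p t = 1"
  then obtain k where "2 * pi * real_of_int t / real p = real_of_int k * (2 * pi)"
    by (auto simp: character_def cis_eq_1_iff)
  then have "real_of_int t = real_of_int (k * int p)" using assms(1) by (simp add: field_simps)
  then have "t = k * int p" by (simp only: of_int_eq_iff)
  then show False using assms(2) by simp
qed

lemma sum_GFp: "sum f (GFp p) = (\<Sum>j<p. f (int j))"
proof -
  have "GFp p = int ` {..<p}"
    unfolding GFp_def by (simp add: image_int_atLeastLessThan lessThan_atLeast0)
  then show ?thesis by (simp add: sum.reindex)
qed

lemma sum_character: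
  assumes "p > 0"
  shows "(\<Sum>b\<in>GFp p. character p (b * t)) = (if int p dvd t then of_nat p else 0)"
proof (cases "int p dvd t")
  case True
  then have "character p (b * t) = 1" for b
    using character_multiple[OF assms] by (metis dvd_def mult.left_commute)
  then show ?thesis using True by (simp add: card_GFp)
next
  case False
  have "(\<Sum>b\<in>GFp p. character p (b * t)) = (\<Sum>j<p. character p t ^ j)"
    by (simp add: sum_GFp character_power)
  also have "\<dots> = 0"
  proof -
    have "character p t ^ p = 1"
      using character_multiple[OF assms, of t] by (simp only: character_power)
    then show ?thesis using character_neq_1[OF assms False] by (simp only: sum_gp_strict) simp
  qed
  finally show ?thesis using False by simp
qed

text \<open>Let u be the value of the character. The powers u^j with j < p sum to 0, so the
  differences u^j - 1 sum to -p, while each of them has modulus at most p |u - 1|.\<close>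

lemma character_separated:
  assumes p: "p > 0" and t: "\<not> int p dvd t"
  shows "1 / real p \<le> cmod (character p t - 1)"
proof -
  have power: "cmod (character p t ^ j - 1) \<le> real j * cmod (character p t - 1)" for j
  proof (induction j)
    case (Suc j)
    have step: "character p t ^ Suc j - 1 = character p t * (character p t ^ j - 1) + (character p t - 1)"
      by (simp add: algebra_simps)
    have "cmod (character p t ^ Suc j - 1) \<le> cmod (character p t ^ j - 1) + cmod (character p t - 1)"
      unfolding step
      using norm_triangle_ineq[of "character p t * (character p t ^ j - 1)" "character p t - 1"]
      by (simp only: norm_mult norm_character mult_1)
    then show ?case using Suc by (simp add: distrib_right)
  qed simp
  have "(\<Sum>j<p. character p t ^ j) = 0"
    using sum_character[OF p, of t] t by (simp add: sum_GFp character_power)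
  then have "of_nat p = - (\<Sum>j<p. character p t ^ j - 1)" by (simp add: sum_subtractf)
  then have "real p = cmod (\<Sum>j<p. character p t ^ j - 1)"
    by (metis norm_minus_cancel norm_of_nat)
  also have "\<dots> \<le> (\<Sum>j<p. real p * cmod (character p t - 1))"
  proof (rule sum_norm_le)
    fix j assume "j \<in> {..<p}"
    then have "real j * cmod (character p t - 1) \<le> real p * cmod (character p t - 1)"
      by (intro mult_right_mono) auto
    then show "cmod (character p t ^ j - 1) \<le> real p * cmod (character p t - 1)"
      using power[of j] by linarith
  qed
  finally show ?thesis using p by (simp add: field_simps)
qed

text \<open>The indicator of g x = v g is an average of p characters with unimodular coefficients,
  so some frequency keeps the correlation without loss. The polynomials are treated one at a time,
  each chosen character being absorbed into w.\<close>

lemma character_correlation_of_fibre: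
  fixes w :: "(nat \<Rightarrow> int) \<Rightarrow> complex"
  assumes p: "p > 0" and "finite T" and T: "\<And>g x. g \<in> T \<Longrightarrow> x \<in> points p n \<Longrightarrow> g x \<in> GFp p"
    and v: "\<And>g. g \<in> T \<Longrightarrow> v g \<in> GFp p"
    and large: "\<rho> \<le> cmod (\<Sum>x\<in>points p n. if \<forall>g\<in>T. g x = v g then w x else 0)"
  shows "\<exists>b. \<rho> \<le> cmod (\<Sum>x\<in>points p n. w x * character p (\<Sum>g\<in>T. b g * g x))"
  using assms(2-)
proof (induction T arbitrary: w rule: finite_induct)
  case empty
  then show ?case by simp
next
  case (insert g T)
  define S where "S b = (\<Sum>x\<in>points p n. if \<forall>g\<in>T. g x = v g then w x * character p (b * g x) else 0)" for b
  have delta: "(if \<forall>g\<in>insert g T. g x = v g then w x else 0)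
     = (1 / of_nat p) * (\<Sum>b\<in>GFp p. character p (- b * v g) *
         (if \<forall>g\<in>T. g x = v g then w x * character p (b * g x) else 0))" if x: "x \<in> points p n" for x
  proof -
    have "(\<Sum>b\<in>GFp p. character p (- b * v g) * (w x * character p (b * g x)))
      = w x * (\<Sum>b\<in>GFp p. character p (b * (g x - v g)))"
      unfolding sum_distrib_left
      by (rule sum.cong) (simp_all add: right_diff_distrib character_diff character_minus)
    also have "\<dots> = of_nat p * (if g x = v g then w x else 0)"
    proof -
      have "int p dvd g x - v g \<longleftrightarrow> g x = v g"
        using insert.prems(1)[of g x] insert.prems(2)[of g] x
        by (auto simp: GFp_def simp flip: mod_eq_dvd_iff)
      then show ?thesis using sum_character[OF p, of "g x - v g"] by simp
    qed
    finally have eq: "(\<Sum>b\<in>GFp p. character p (- b * v g) * (w x * character p (b * g x)))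
      = of_nat p * (if g x = v g then w x else 0)" .
    show ?thesis
    proof (cases "\<forall>g\<in>T. g x = v g")
      case True
      then have "(\<forall>g\<in>insert g T. g x = v g) = (g x = v g)" by simp
      with True eq p show ?thesis by (simp only: if_True) simp
    next
      case False
      then have "(\<forall>g\<in>insert g T. g x = v g) = False" by blast
      with False show ?thesis by (simp only: if_False mult_zero_right sum.neutral_const)
    qed
  qed
  have "(\<Sum>x\<in>points p n. if \<forall>g\<in>insert g T. g x = v g then w x else 0)
    = (1 / of_nat p) * (\<Sum>x\<in>points p n. \<Sum>b\<in>GFp p. character p (- b * v g) *
         (if \<forall>g\<in>T. g x = v g then w x * character p (b * g x) else 0))"
  proof -
    have "(\<Sum>x\<in>points p n. if \<forall>g\<in>insert g T. g x = v g then w x else 0)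
      = (\<Sum>x\<in>points p n. (1 / of_nat p) * (\<Sum>b\<in>GFp p. character p (- b * v g) *
         (if \<forall>g\<in>T. g x = v g then w x * character p (b * g x) else 0)))"
      using delta by (rule sum.cong[OF refl])
    then show ?thesis unfolding sum_distrib_left[symmetric, of "1 / of_nat p"] .
  qed
  also have "\<dots> = (1 / of_nat p) * (\<Sum>b\<in>GFp p. character p (- b * v g) * S b)"
    by (subst sum.swap) (simp add: S_def sum_distrib_left)
  finally have "\<rho> \<le> cmod ((1 / of_nat p) * (\<Sum>b\<in>GFp p. character p (- b * v g) * S b))"
    using insert.prems(3) by simp
  also have "\<dots> = (1 / real p) * cmod (\<Sum>b\<in>GFp p. character p (- b * v g) * S b)"
    by (simp add: norm_mult norm_divide)
  finally have "real p * \<rho> \<le> cmod (\<Sum>b\<in>GFp p. character p (- b * v g) * S b)"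
    using p by (simp add: field_simps)
  also have "\<dots> \<le> (\<Sum>b\<in>GFp p. cmod (S b))"
    by (rule sum_norm_le) (simp add: norm_mult)
  finally have "\<exists>c\<in>GFp p. \<rho> \<le> cmod (S c)"
    using sum_strict_mono[OF finite_GFp, of p "\<lambda>b. cmod (S b)" "\<lambda>b. \<rho>"] p card_GFp[of p]
    by (force simp: not_le)
  then obtain c where "\<rho> \<le> cmod (S c)" by blast
  then obtain b where b: "\<rho> \<le> cmod (\<Sum>x\<in>points p n. w x * character p (c * g x) * character p (\<Sum>g\<in>T. b g * g x))"
    using insert.IH[of "\<lambda>x. w x * character p (c * g x)"] insert.prems(1,2) unfolding S_def by blast
  have "(\<Sum>h\<in>insert g T. (b(g := c)) h * h x) = c * g x + (\<Sum>h\<in>T. b h * h x)" for x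
  proof -
    have "(\<Sum>h\<in>T. (b(g := c)) h * h x) = (\<Sum>h\<in>T. b h * h x)"
      using insert.hyps by (intro sum.cong) auto
    then show ?thesis using insert.hyps by simp
  qed
  then show ?case using b by (intro exI[of _ "b(g := c)"]) (simp add: character_add mult.assoc)
qed

subsection \<open>The large spectrum\<close>

lemma cmod_sum_squared_le:
  fixes u :: "'a \<Rightarrow> complex"
  shows "(\<Sum>x\<in>X. cmod (u x))\<^sup>2 \<le> real (card X) * (\<Sum>x\<in>X. (cmod (u x))\<^sup>2)"
  using sum_squared_le_sum_of_squares[of "\<lambda>x. cmod (u x)" X] by (simp only: mult.commute)

text \<open>An inequality of Bessel type. Aligning phases turns the sum of the moduli of the
  correlations into the correlation of w with the single function F; by Cauchy-Schwarz this is
  controlled by the square norm of F, whose diagonal and off-diagonal terms give the two summands on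
  the right.\<close>

lemma almost_orthogonal_correlations:
  fixes w :: "'a \<Rightarrow> complex" and \<psi> :: "'b \<Rightarrow> 'a \<Rightarrow> complex" and \<rho> \<delta> :: real
  assumes "finite L" "finite X" and w: "\<And>x. x \<in> X \<Longrightarrow> cmod (w x) \<le> 1"
    and \<psi>: "\<And>q x. cmod (\<psi> q x) \<le> 1"
    and large: "\<And>q. q \<in> L \<Longrightarrow> \<rho> * card X \<le> cmod (\<Sum>x\<in>X. w x * \<psi> q x)"
    and orth: "\<And>q q'. q \<in> L \<Longrightarrow> q' \<in> L \<Longrightarrow> q \<noteq> q' \<Longrightarrow> cmod (\<Sum>x\<in>X. \<psi> q x * cnj (\<psi> q' x)) \<le> \<delta> * card X"
    and "\<rho> \<ge> 0" "\<delta> \<ge> 0" "X \<noteq> {}"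
  shows "card L * \<rho>\<^sup>2 \<le> 1 + card L * \<delta>"
proof -
  define s where "s q = (\<Sum>x\<in>X. w x * \<psi> q x)" for q
  define \<theta> where "\<theta> q = cnj (sgn (s q))" for q
  define F where "F x = (\<Sum>q\<in>L. \<theta> q * \<psi> q x)" for x
  have \<theta>: "cmod (\<theta> q) \<le> 1" for q by (simp add: \<theta>_def norm_sgn)
  have \<theta>s: "\<theta> q * s q = of_real (cmod (s q))" for q
  proof (cases "s q = 0")
    case False
    have "cnj (s q) * s q = of_real (cmod (s q)) * of_real (cmod (s q))"
      by (metis complex_norm_square mult.commute of_real_mult power2_eq_square)
    then show ?thesis using False by (simp add: \<theta>_def sgn_eq field_simps)
  qed simp
  have "card L * (\<rho> * card X) \<le> (\<Sum>q\<in>L. cmod (s q))"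
    using sum_mono[of L "\<lambda>_. \<rho> * card X" "\<lambda>q. cmod (s q)"] large by (simp add: s_def)
  also have "\<dots> = cmod (\<Sum>q\<in>L. \<theta> q * s q)"
    unfolding \<theta>s by (simp add: sum_nonneg flip: of_real_sum)
  also have "(\<Sum>q\<in>L. \<theta> q * s q) = (\<Sum>x\<in>X. w x * F x)"
    unfolding s_def F_def sum_distrib_left by (subst sum.swap) (simp add: mult_ac)
  also have "cmod (\<Sum>x\<in>X. w x * F x) \<le> (\<Sum>x\<in>X. cmod (F x))"
    using w by (intro sum_norm_le) (simp add: norm_mult mult_left_le_one_le)
  finally have "(card L * (\<rho> * card X))\<^sup>2 \<le> (\<Sum>x\<in>X. cmod (F x))\<^sup>2"
    using assms(7) by (intro power_mono) auto
  also have "\<dots> \<le> card X * (\<Sum>x\<in>X. (cmod (F x))\<^sup>2)" by (rule cmod_sum_squared_le)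
  also have "(\<Sum>x\<in>X. (cmod (F x))\<^sup>2) \<le> card L * card X + card L * card L * (\<delta> * card X)"
  proof -
    have "complex_of_real (\<Sum>x\<in>X. (cmod (F x))\<^sup>2)
      = (\<Sum>x\<in>X. \<Sum>q\<in>L. \<Sum>q'\<in>L. (\<theta> q * cnj (\<theta> q')) * (\<psi> q x * cnj (\<psi> q' x)))"
      unfolding of_real_sum complex_norm_square F_def cnj_sum sum_product
      by (simp add: mult_ac)
    also have "\<dots> = (\<Sum>q\<in>L. \<Sum>q'\<in>L. (\<theta> q * cnj (\<theta> q')) * (\<Sum>x\<in>X. \<psi> q x * cnj (\<psi> q' x)))"
      unfolding sum_distrib_left
      by (subst sum.swap, rule sum.cong[OF refl], rule sum.swap)
    finally have "(\<Sum>x\<in>X. (cmod (F x))\<^sup>2)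
      = cmod (\<Sum>q\<in>L. \<Sum>q'\<in>L. (\<theta> q * cnj (\<theta> q')) * (\<Sum>x\<in>X. \<psi> q x * cnj (\<psi> q' x)))"
      using norm_of_real[of "\<Sum>x\<in>X. (cmod (F x))\<^sup>2", where 'a = complex]
        sum_nonneg[of X "\<lambda>x. (cmod (F x))\<^sup>2"] by (simp only: abs_of_nonneg zero_le_power2)
    \<comment> \<open>The off-diagonal bound is granted to the diagonal as well, which makes the
      double sum immediate.\<close>
    also have "\<dots> \<le> (\<Sum>q\<in>L. \<Sum>q'\<in>L. (if q = q' then real (card X) else 0) + \<delta> * card X)"
    proof (intro sum_norm_le)
      fix q q' assume q: "q \<in> L" "q' \<in> L"
      have "cmod ((\<theta> q * cnj (\<theta> q')) * (\<Sum>x\<in>X. \<psi> q x * cnj (\<psi> q' x)))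
        \<le> 1 * cmod (\<Sum>x\<in>X. \<psi> q x * cnj (\<psi> q' x))"
        unfolding norm_mult using \<theta>[of q] \<theta>[of q'] by (intro mult_right_mono) (auto simp: mult_le_one)
      moreover have "cmod (\<Sum>x\<in>X. \<psi> q x * cnj (\<psi> q x)) \<le> (\<Sum>x\<in>X. 1)"
        using \<psi> by (intro sum_norm_le) (simp add: norm_mult mult_le_one)
      moreover have "\<delta> * card X \<ge> 0" using assms(8) by simp
      ultimately show "cmod ((\<theta> q * cnj (\<theta> q')) * (\<Sum>x\<in>X. \<psi> q x * cnj (\<psi> q' x)))
          \<le> (if q = q' then real (card X) else 0) + \<delta> * card X"
        using orth[OF q] by fastforce
    qed
    also have "\<dots> = card L * card X + card L * card L * (\<delta> * card X)"
      using assms(1) by (simp add: sum.distrib distrib_left)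
    finally show ?thesis .
  qed
  finally have main: "(card L * (\<rho> * card X))\<^sup>2 \<le> card X * (card L * card X + card L * card L * (\<delta> * card X))"
    by (simp add: mult_left_mono)
  have X: "real (card X) > 0" using assms by (simp add: card_gt_0_iff)
  show ?thesis
  proof (cases "card L = 0")
    case False
    then have "real (card L) * (real (card X))\<^sup>2 * (card L * \<rho>\<^sup>2) \<le> real (card L) * (real (card X))\<^sup>2 * (1 + card L * \<delta>)"
      using main by (simp add: power2_eq_square algebra_simps)
    moreover have "real (card L) * (real (card X))\<^sup>2 > 0" using False X by simp
    ultimately show ?thesis by (rule mult_left_le_imp_le)
  qed simp
qed

text \<open>L is a maximal almost orthogonal subset of the large spectrum of w. Almost orthogonality
  bounds its size, and by maximality every other P in the spectrum correlates with a member of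
  L.\<close>

lemma large_spectrum_list:
  fixes w :: "(nat \<Rightarrow> int) \<Rightarrow> complex"
  assumes p: "p \<ge> 2" and w: "\<And>x. x \<in> points p n \<Longrightarrow> cmod (w x) \<le> 1"
  obtains L where "L \<subseteq> RM p n e" "card L \<le> p ^ (2 * r + 1)"
    "\<And>P. P \<in> RM p n e \<Longrightarrow> real (p ^ n) / real p ^ r \<le> cmod (\<Sum>x\<in>points p n. w x * character p (P x)) \<Longrightarrow>
      \<exists>Q\<in>L. real (p ^ n) / real p ^ (2 * r + 1) \<le> cmod (\<Sum>x\<in>points p n. character p (P x - Q x))"
proof -
  let ?N = "real (p ^ n)" and ?X = "points p n"
  define \<rho> where "\<rho> = 1 / real p ^ r"
  \<comment> \<open>Chosen so that \<open>\<rho>\<^sup>2 = real p * \<delta>\<close>: with p \<ge> 2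
    the term with \<delta> in the previous inequality is absorbed, and |L| \<le> 1 / \<delta>
    remains.\<close>
  define \<delta> where "\<delta> = 1 / real p ^ (2 * r + 1)"
  define corr where "corr P Q = cmod (\<Sum>x\<in>?X. character p (P x - Q x))" for P Q :: pfun
  define Sp where "Sp = {P \<in> RM p n e. \<rho> * ?N \<le> cmod (\<Sum>x\<in>?X. w x * character p (P x))}"
  define \<L> where "\<L> = {L. L \<subseteq> Sp \<and> (\<forall>P\<in>L. \<forall>Q\<in>L. P \<noteq> Q \<longrightarrow> corr P Q < \<delta> * ?N)}"
  have sym: "corr P Q = corr Q P" for P Q
  proof -
    have "(\<Sum>x\<in>?X. character p (Q x - P x)) = cnj (\<Sum>x\<in>?X. character p (P x - Q x))"
      by (simp flip: character_minus)
    then show ?thesis unfolding corr_def by (simp only: complex_mod_cnj)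
  qed
  have "finite Sp" using finite_RM by (rule rev_finite_subset) (auto simp: Sp_def)
  then have "finite \<L>" by (intro finite_subset[of \<L> "Pow Sp"]) (auto simp: \<L>_def)
  moreover have "{} \<in> \<L>" by (simp add: \<L>_def)
  ultimately obtain L where L: "L \<in> \<L>" and max: "\<And>L'. L' \<in> \<L> \<Longrightarrow> L \<subseteq> L' \<Longrightarrow> L = L'"
    using finite_has_maximal[of \<L>] by blast
  have finL: "finite L" using L \<open>finite Sp\<close> finite_subset by (auto simp: \<L>_def)
  have ne: "?X \<noteq> {}"
  proof -
    have "card ?X > 0" using p by (simp add: card_points)
    then show ?thesis by auto
  qed
  have "card L * \<rho>\<^sup>2 \<le> 1 + card L * \<delta>"
  proof (rule almost_orthogonal_correlations[of L ?X w "\<lambda>P x. character p (P x)"])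
    fix q assume "q \<in> L"
    then show "\<rho> * card ?X \<le> cmod (\<Sum>x\<in>?X. w x * character p (q x))"
      using L by (auto simp: \<L>_def Sp_def card_points)
  next
    fix q q' assume "q \<in> L" "q' \<in> L" "q \<noteq> q'"
    then have "corr q q' < \<delta> * ?N" using L by (auto simp: \<L>_def)
    then show "cmod (\<Sum>x\<in>?X. character p (q x) * cnj (character p (q' x))) \<le> \<delta> * card ?X"
      by (simp add: corr_def character_diff card_points)
  qed (use w finL ne in \<open>auto simp: finite_points \<rho>_def \<delta>_def\<close>)
  moreover have "\<rho>\<^sup>2 = real p * \<delta>"
    using p by (simp add: \<rho>_def \<delta>_def power_divide power_mult power2_eq_square mult.commute flip: power_mult_distrib)
  ultimately have "card L * (real p * \<delta>) \<le> 1 + card L * \<delta>" by simp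
  moreover have "card L * (2 * \<delta>) \<le> card L * (real p * \<delta>)"
    using p by (intro mult_left_mono mult_right_mono) (auto simp: \<delta>_def)
  ultimately have "card L * \<delta> \<le> 1" by linarith
  then have "real (card L) \<le> real p ^ (2 * r + 1)" using p by (simp add: \<delta>_def field_simps)
  then have cardL: "card L \<le> p ^ (2 * r + 1)" by (metis of_nat_le_iff of_nat_power)
  have "\<exists>Q\<in>L. \<delta> * ?N \<le> corr P Q" if P: "P \<in> Sp" for P
  proof (cases "P \<in> L")
    case True
    have "1 \<le> real p ^ (2 * r + 1)" using p by (intro one_le_power) simp
    then have "\<delta> \<le> 1" by (simp only: \<delta>_def divide_le_eq_1) simp
    then have "\<delta> * ?N \<le> 1 * ?N" by (rule mult_right_mono) simp
    also have "\<dots> = corr P P" by (simp add: corr_def card_points norm_power)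
    finally show ?thesis using True by blast
  next
    case False
    then have "insert P L \<notin> \<L>" using max[of "insert P L"] by auto
    then obtain A B where "A \<in> insert P L" "B \<in> insert P L" "A \<noteq> B" "\<delta> * ?N \<le> corr A B"
      using L P unfolding \<L>_def by (auto simp: not_less)
    moreover have "\<not> (A \<in> L \<and> B \<in> L)" using L calculation unfolding \<L>_def by force
    ultimately show ?thesis using sym by auto
  qed
  then show ?thesis
    using L cardL by (intro that[of L]) (auto simp: \<L>_def Sp_def corr_def \<rho>_def \<delta>_def)
qed

subsection \<open>Biased polynomials\<close>

lemma eq_of_mod_eq: "a \<in> GFp p \<Longrightarrow> b \<in> GFp p \<Longrightarrow> int p dvd a - b \<Longrightarrow> a = b"
  by (auto simp: GFp_def simp flip: mod_eq_dvd_iff)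

lemma bij_betw_shift_base:
  assumes p: "p > 0"
  shows "bij_betw (\<lambda>x. shift p n x a y) (points p n) (points p n)"
proof -
  have "inj_on (\<lambda>x. shift p n x a y) (points p n)"
  proof (rule inj_onI)
    fix x z assume x: "x \<in> points p n" and z: "z \<in> points p n" and eq: "shift p n x a y = shift p n z a y"
    show "x = z"
    proof (rule PiE_ext[OF x[unfolded points_def] z[unfolded points_def]])
      fix i assume i: "i \<in> {..<n}"
      have "(x i + a * y i) mod int p = (z i + a * y i) mod int p"
        using fun_cong[OF eq, of i] i by (simp add: shift_def)
      then have "int p dvd x i - z i" by (simp add: mod_eq_dvd_iff)
      then show "x i = z i" using x z i by (intro eq_of_mod_eq) (auto simp: points_def)
    qed
  qed
  moreover have "(\<lambda>x. shift p n x a y) ` points p n \<subseteq> points p n" using shift_in_points[OF p] by auto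
  ultimately show ?thesis
    unfolding bij_betw_def using endo_inj_surj[OF finite_points] by blast
qed

lemma bij_betw_shift_direction:
  assumes p: "prime p" and a: "\<not> int p dvd a"
  shows "bij_betw (\<lambda>y. shift p n x a y) (points p n) (points p n)"
proof -
  have p0: "p > 0" using p prime_gt_0_nat by blast
  have "inj_on (\<lambda>y. shift p n x a y) (points p n)"
  proof (rule inj_onI)
    fix y z assume y: "y \<in> points p n" and z: "z \<in> points p n" and eq: "shift p n x a y = shift p n x a z"
    show "y = z"
    proof (rule PiE_ext[OF y[unfolded points_def] z[unfolded points_def]])
      fix i assume i: "i \<in> {..<n}"
      have "(x i + a * y i) mod int p = (x i + a * z i) mod int p"
        using fun_cong[OF eq, of i] i by (simp add: shift_def)
      then have "int p dvd a * (y i - z i)" by (simp add: mod_eq_dvd_iff right_diff_distrib)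
      then have "int p dvd y i - z i" using p a by (simp add: prime_dvd_mult_iff)
      then show "y i = z i" using y z i by (intro eq_of_mod_eq) (auto simp: points_def)
    qed
  qed
  moreover have "(\<lambda>y. shift p n x a y) ` points p n \<subseteq> points p n" using shift_in_points[OF p0] by auto
  ultimately show ?thesis
    unfolding bij_betw_def using endo_inj_surj[OF finite_points] by blast
qed

lemma shift_shift: "shift p n (shift p n x a y) b y = shift p n x (a + b) y"
  by (auto simp: shift_def fun_eq_iff mod_simps algebra_simps)

lemma sum_shift_base:
  "p > 0 \<Longrightarrow> (\<Sum>x\<in>points p n. h (shift p n x a y)) = (\<Sum>x\<in>points p n. h x)"
  by (rule sum.reindex_bij_betw[OF bij_betw_shift_base])

lemma sum_rotate:
  "(\<Sum>x\<in>X. \<Sum>a\<in>A. \<Sum>b\<in>B. t x a b) = (\<Sum>a\<in>A. \<Sum>b\<in>B. \<Sum>x\<in>X. t x a b)"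
  by (subst sum.swap) (intro sum.cong refl sum.swap)

text \<open>For a \<noteq> b the points x + a y and x + b y are independent when x and y are
  uniform, since b - a is invertible modulo p. As h has mean zero, only the p diagonal terms of the
  expanded square survive; after division by p squared the variance has dropped by the factor
  p.\<close>

lemma sum_norm_line_average:
  fixes h :: "(nat \<Rightarrow> int) \<Rightarrow> complex"
  assumes p: "prime p" and h0: "(\<Sum>x\<in>points p n. h x) = 0"
  shows "(\<Sum>y\<in>points p n. \<Sum>x\<in>points p n. (cmod (\<Sum>a\<in>GFp p. h (shift p n x a y)))\<^sup>2)
    = real (p ^ n) * (real p * (\<Sum>x\<in>points p n. (cmod (h x))\<^sup>2))"
proof -
  let ?X = "points p n"
  have p0: "p > 0" using p prime_gt_0_nat by blast
  have pair: "(\<Sum>y\<in>?X. \<Sum>x\<in>?X. h (shift p n x a y) * cnj (h (shift p n x b y)))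
      = (if a = b then of_nat (p ^ n) * (\<Sum>x\<in>?X. h x * cnj (h x)) else 0)"
    if ab: "a \<in> GFp p" "b \<in> GFp p" for a b
  proof -
    have "(\<Sum>x\<in>?X. h (shift p n x a y) * cnj (h (shift p n x b y)))
      = (\<Sum>x\<in>?X. h x * cnj (h (shift p n x (b - a) y)))" for y
      using sum_shift_base[OF p0, where h = "\<lambda>x. h x * cnj (h (shift p n x (b - a) y))" and n = n and a = a and y = y]
      by (simp add: shift_shift)
    then have eq: "(\<Sum>y\<in>?X. \<Sum>x\<in>?X. h (shift p n x a y) * cnj (h (shift p n x b y)))
       = (\<Sum>x\<in>?X. h x * cnj (\<Sum>y\<in>?X. h (shift p n x (b - a) y)))"
      by (simp add: sum_distrib_left) (rule sum.swap)
    show ?thesis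
    proof (cases "a = b")
      case True
      have "shift p n x 0 y = x" if "x \<in> ?X" for x y
        using that by (auto simp: shift_def points_def GFp_def fun_eq_iff PiE_iff extensional_def)
      then have "(\<Sum>y\<in>?X. h (shift p n x (b - a) y)) = of_nat (p ^ n) * h x" if "x \<in> ?X" for x
        using True that by (simp add: card_points)
      then have "(\<Sum>x\<in>?X. h x * cnj (\<Sum>y\<in>?X. h (shift p n x (b - a) y)))
        = (\<Sum>x\<in>?X. of_nat (p ^ n) * (h x * cnj (h x)))"
        by (intro sum.cong) simp_all
      then show ?thesis using eq True by (simp add: sum_distrib_left)
    next
      case False
      then have "\<not> int p dvd b - a" using eq_of_mod_eq[of b p a] ab by blast
      then have "(\<Sum>y\<in>?X. h (shift p n x (b - a) y)) = 0" for x
        using sum.reindex_bij_betw[OF bij_betw_shift_direction[OF p], of "b - a" h n x] h0 by simp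
      then show ?thesis using eq False by simp
    qed
  qed
  have "complex_of_real (\<Sum>y\<in>?X. \<Sum>x\<in>?X. (cmod (\<Sum>a\<in>GFp p. h (shift p n x a y)))\<^sup>2)
    = (\<Sum>y\<in>?X. \<Sum>x\<in>?X. \<Sum>a\<in>GFp p. \<Sum>b\<in>GFp p. h (shift p n x a y) * cnj (h (shift p n x b y)))"
    unfolding of_real_sum complex_norm_square cnj_sum sum_product ..
  also have "\<dots> = (\<Sum>a\<in>GFp p. \<Sum>b\<in>GFp p. \<Sum>y\<in>?X. \<Sum>x\<in>?X. h (shift p n x a y) * cnj (h (shift p n x b y)))"
    by (subst sum_rotate[symmetric], intro sum.cong refl sum_rotate)
  also have "\<dots> = (\<Sum>a\<in>GFp p. \<Sum>b\<in>GFp p. if a = b then of_nat (p ^ n) * (\<Sum>x\<in>?X. h x * cnj (h x)) else 0)"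
    using pair by (intro sum.cong refl)
  also have "\<dots> = complex_of_real (real (p ^ n) * (real p * (\<Sum>x\<in>?X. (cmod (h x))\<^sup>2)))"
    using finite_GFp[of p] card_GFp[of p]
    unfolding of_real_mult of_real_sum complex_norm_square of_real_of_nat_eq by simp
  finally show ?thesis by (simp only: of_real_eq_iff)
qed

text \<open>Averaging over the lines in one further direction gains a factor p in the variance, and the
  derivatives of the polynomials involved in that direction determine the new average up to the
  phase of R at the base point.\<close>

lemma low_variance_average:
  assumes p: "prime p" and R: "R \<in> RM p n e" and "e \<ge> 1"
    and \<beta>: "(\<Sum>x\<in>points p n. character p (R x)) = of_nat (p ^ n) * \<beta>" "cmod \<beta> \<le> 1"
  shows "\<exists>Z D. D \<subseteq> RM p n (e - 1) \<and> card D < Suc e ^ c \<and>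
    (\<Sum>x\<in>points p n. Z x) = of_nat (p ^ n) * \<beta> \<and>
    (\<Sum>x\<in>points p n. (cmod (Z x - \<beta>))\<^sup>2) \<le> 4 * real (p ^ n) / real p ^ c \<and>
    (\<forall>x\<in>points p n. \<forall>z\<in>points p n. agree D x z \<longrightarrow>
       Z x * cnj (character p (R x)) = Z z * cnj (character p (R z)))"
proof (induction c)
  \<comment> \<open>Without averaging, Z is the phase of R itself, and its product with the
    conjugate phase is the constant 1; so D can be empty.\<close>
  case 0
  have "(cmod (character p (R x) - \<beta>))\<^sup>2 \<le> 2\<^sup>2" for x
    using \<beta>(2) norm_triangle_ineq4[of "character p (R x)" \<beta>] by (intro power_mono) auto
  then have "(\<Sum>x\<in>points p n. (cmod (character p (R x) - \<beta>))\<^sup>2) \<le> (\<Sum>x\<in>points p n. 4)"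
    by (intro sum_mono) simp
  then show ?case using \<beta>(1)
    by (intro exI[of _ "\<lambda>x. character p (R x)"] exI[of _ "{}"]) (simp add: card_points mult.commute)
next
  case (Suc c)
  let ?X = "points p n" and ?N = "real (p ^ n)"
  have p0: "p > 0" using p prime_gt_0_nat by blast
  from Suc obtain Z D where D: "D \<subseteq> RM p n (e - 1)" "card D < Suc e ^ c"
    and Z: "(\<Sum>x\<in>?X. Z x) = of_nat (p ^ n) * \<beta>" 
      "(\<Sum>x\<in>?X. (cmod (Z x - \<beta>))\<^sup>2) \<le> 4 * ?N / real p ^ c"
    and det: "\<And>x z. x \<in> ?X \<Longrightarrow> z \<in> ?X \<Longrightarrow> agree D x z \<Longrightarrow>
       Z x * cnj (character p (R x)) = Z z * cnj (character p (R z))" by blast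
  have finD: "finite D" using D(1) finite_RM finite_subset by blast
  define h where "h x = Z x - \<beta>" for x
  have h0: "(\<Sum>x\<in>?X. h x) = 0" by (simp add: h_def sum_subtractf Z(1) card_points)
  \<comment> \<open>By \<open>sum_norm_line_average\<close> the mean over y of the left side equals
    the right side, so some direction does no worse.\<close>
  have "\<exists>y\<in>?X. (\<Sum>x\<in>?X. (cmod (\<Sum>a\<in>GFp p. h (shift p n x a y)))\<^sup>2) \<le> real p * (\<Sum>x\<in>?X. (cmod (h x))\<^sup>2)"
  proof (rule ccontr)
    assume "\<not> ?thesis"
    moreover have "card ?X > 0" using p0 by (simp add: card_points)
    ultimately have "(\<Sum>y\<in>?X. real p * (\<Sum>x\<in>?X. (cmod (h x))\<^sup>2))
      < (\<Sum>y\<in>?X. \<Sum>x\<in>?X. (cmod (\<Sum>a\<in>GFp p. h (shift p n x a y)))\<^sup>2)"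
      by (intro sum_strict_mono) (auto simp: finite_points not_le)
    then show False using sum_norm_line_average[OF p h0] by (simp add: card_points)
  qed
  then obtain y where y: "(\<Sum>x\<in>?X. (cmod (\<Sum>a\<in>GFp p. h (shift p n x a y)))\<^sup>2) \<le> real p * (\<Sum>x\<in>?X. (cmod (h x))\<^sup>2)"
    by blast
  define Z' where "Z' x = (\<Sum>a\<in>GFp p. Z (shift p n x a y)) / of_nat p" for x
  have "(\<Sum>x\<in>?X. Z' x) = (\<Sum>a\<in>GFp p. \<Sum>x\<in>?X. Z (shift p n x a y)) / of_nat p"
    unfolding Z'_def sum_divide_distrib[symmetric] by (subst sum.swap) simp
  also have "\<dots> = (\<Sum>x\<in>?X. Z x)"
    using p0 by (simp add: sum_shift_base card_GFp)
  finally have Z'1: "(\<Sum>x\<in>?X. Z' x) = of_nat (p ^ n) * \<beta>" using Z(1) by simp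
  have "Z' x - \<beta> = (\<Sum>a\<in>GFp p. h (shift p n x a y)) / of_nat p" for x
    using p0 by (simp add: Z'_def h_def sum_subtractf card_GFp diff_divide_distrib)
  then have "(cmod (Z' x - \<beta>))\<^sup>2 = (cmod (\<Sum>a\<in>GFp p. h (shift p n x a y)))\<^sup>2 / (real p)\<^sup>2" for x
    by (simp add: norm_divide power_divide)
  then have "(\<Sum>x\<in>?X. (cmod (Z' x - \<beta>))\<^sup>2) = (\<Sum>x\<in>?X. (cmod (\<Sum>a\<in>GFp p. h (shift p n x a y)))\<^sup>2) / (real p)\<^sup>2"
    by (simp only: sum_divide_distrib)
  also have "\<dots> \<le> (real p * (4 * ?N / real p ^ c)) / (real p)\<^sup>2"
    using y Z(2) p0 unfolding h_def by (intro divide_right_mono order_trans[OF y[unfolded h_def]] mult_left_mono) auto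
  also have "\<dots> = 4 * ?N / real p ^ Suc c" using p0 by (simp add: power2_eq_square)
  finally have Z'2: "(\<Sum>x\<in>?X. (cmod (Z' x - \<beta>))\<^sup>2) \<le> 4 * ?N / real p ^ Suc c" .
  obtain A where A: "A \<subseteq> RM p n (e - 1)" "card A \<le> e"
    "\<And>x z a. x \<in> ?X \<Longrightarrow> z \<in> ?X \<Longrightarrow> agree A x z \<Longrightarrow>
       (R (shift p n x a y) - R x) mod int p = (R (shift p n z a y) - R z) mod int p"
    using RM_taylor[OF R p0, of y] by blast
  have "\<exists>B. B \<subseteq> RM p n (e - 1) \<and> card B \<le> e \<and>
    (\<forall>x z a. x \<in> ?X \<longrightarrow> z \<in> ?X \<longrightarrow> agree B x z \<longrightarrow>
       (g (shift p n x a y) - g x) mod int p = (g (shift p n z a y) - g z) mod int p)" if g: "g \<in> D" for g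
  proof -
    have "g \<in> RM p n (e - 1)" using g D(1) by blast
    from RM_taylor[OF this p0, of y] obtain B where "B \<subseteq> RM p n (e - 1 - 1)" "card B \<le> e - 1"
      "\<And>x z a. x \<in> ?X \<Longrightarrow> z \<in> ?X \<Longrightarrow> agree B x z \<Longrightarrow>
       (g (shift p n x a y) - g x) mod int p = (g (shift p n z a y) - g z) mod int p" by blast
    moreover have "RM p n (e - 1 - 1) \<subseteq> RM p n (e - 1)" by (rule RM_mono) simp
    moreover have "e - 1 \<le> e" by simp
    ultimately show ?thesis by (meson order_trans)
  qed
  then obtain B where B: "\<And>g. g \<in> D \<Longrightarrow> B g \<subseteq> RM p n (e - 1)" "\<And>g. g \<in> D \<Longrightarrow> card (B g) \<le> e"
    "\<And>g x z a. g \<in> D \<Longrightarrow> x \<in> ?X \<Longrightarrow> z \<in> ?X \<Longrightarrow> agree (B g) x z \<Longrightarrow>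
       (g (shift p n x a y) - g x) mod int p = (g (shift p n z a y) - g z) mod int p" by metis
  \<comment> \<open>D is kept because g (x + a y) is recovered from g x and its increment, which
    \<open>B g\<close> determines; A determines the increments of R.\<close>
  define D' where "D' = D \<union> (\<Union>g\<in>D. B g) \<union> A"
  have "card D' \<le> card D + card D * e + e"
  proof -
    have "card (\<Union>g\<in>D. B g) \<le> (\<Sum>g\<in>D. card (B g))" using finD by (rule card_UN_le)
    also have "\<dots> \<le> card D * e" using sum_bounded_above[of D "\<lambda>g. card (B g)" e] B(2) by simp
    finally show ?thesis unfolding D'_def using A(2)
      card_Un_le[of D "\<Union>g\<in>D. B g"] card_Un_le[of "D \<union> (\<Union>g\<in>D. B g)" A] by linarith
  qed
  \<comment> \<open>The product exceeds the previous bound by exactly 1, which is why the induction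
    carries a strict inequality for the cardinality.\<close>
  also have "\<dots> < Suc (card D) * Suc e" by simp
  also have "\<dots> \<le> Suc e ^ c * Suc e" using D(2) by (intro mult_right_mono) simp_all
  finally have cardD': "card D' < Suc e ^ Suc c" by (simp add: mult.commute)
  have det': "Z' x * cnj (character p (R x)) = Z' z * cnj (character p (R z))"
    if xz: "x \<in> ?X" "z \<in> ?X" "agree D' x z" for x z
  proof -
    \<comment> \<open>The phase is split at the shifted point: the induction hypothesis controls Z
      relative to the phase there, and A controls the phase there relative to the one at the base
      point.\<close>
    have "Z (shift p n x a y) * cnj (character p (R x)) = Z (shift p n z a y) * cnj (character p (R z))" for a
    proof -
      let ?x = "shift p n x a y" and ?z = "shift p n z a y"
      have agr: "agree D x z" "agree A x z" "\<And>g. g \<in> D \<Longrightarrow> agree (B g) x z"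
        using xz(3) unfolding D'_def agree_def by blast+
      have "agree D ?x ?z"
        unfolding agree_def
      proof
        fix g assume g: "g \<in> D"
        then have gR: "g \<in> RM p n (e - 1)" using D(1) by blast
        have "int p dvd (g ?x - g x) - (g ?z - g z)"
          using B(3)[OF g xz(1,2) agr(3)[OF g], of a] by (simp add: mod_eq_dvd_iff)
        moreover have "g x = g z" using agr(1) g by (simp add: agree_def)
        ultimately have "int p dvd g ?x - g ?z" by simp
        then show "g ?x = g ?z"
          by (rule eq_of_mod_eq[rotated 2]) (rule RM_range[OF gR shift_in_points[OF p0]])+
      qed
      then have "Z ?x * cnj (character p (R ?x)) = Z ?z * cnj (character p (R ?z))"
        using det shift_in_points[OF p0] by blast
      moreover have "character p (R ?x - R x) = character p (R ?z - R z)"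
        using A(3)[OF xz(1,2) agr(2), of a] character_mod[OF p0] by metis
      ultimately have "(Z ?x * cnj (character p (R ?x))) * (character p (R ?x) * cnj (character p (R x)))
        = (Z ?z * cnj (character p (R ?z))) * (character p (R ?z) * cnj (character p (R z)))"
        by (simp only: character_diff)
      moreover have "(u * cnj (character p s)) * (character p s * v) = u * v" for u v s
        using character_mult_cnj[of p s] by (metis mult.assoc mult.commute mult.right_neutral)
      ultimately show ?thesis by simp
    qed
    then show ?thesis by (simp add: Z'_def sum_distrib_right)
  qed
  show ?case
    using D(1) A(1) B(1) cardD' Z'1 Z'2 det'
    by (intro exI[of _ Z'] exI[of _ D']) (auto simp: D'_def)
qed

text \<open>Variant of a lemma of Bogdanov and Viola.\<close>

lemma biased_polynomial_structure:
  assumes p: "prime p" and R: "R \<in> RM p n e" and "e \<ge> 1"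
    and bias: "real (p ^ n) / real p ^ r \<le> cmod (\<Sum>x\<in>points p n. character p (R x))"
  obtains B D where "B \<subseteq> points p n" "real (card B) \<le> real (p ^ n) / real p ^ t"
    "D \<subseteq> RM p n (e - 1)" "card D < Suc e ^ (2 * r + t + 8)"
    "\<And>x z. x \<in> points p n - B \<Longrightarrow> z \<in> points p n - B \<Longrightarrow> agree D x z \<Longrightarrow> R x = R z"
proof -
  let ?X = "points p n" and ?N = "real (p ^ n)"
  have p2: "p \<ge> 2" using p prime_ge_2_nat by blast
  then have p0: "p > 0" by simp
  define \<beta> where "\<beta> = (\<Sum>x\<in>?X. character p (R x)) / of_nat (p ^ n)"
  have "cmod (\<Sum>x\<in>?X. character p (R x)) \<le> (\<Sum>x\<in>?X. 1)" by (rule sum_norm_le) simp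
  then have \<beta>1: "cmod \<beta> \<le> 1"
    using p0 by (simp add: \<beta>_def norm_divide norm_power card_points)
  have \<beta>r: "1 / real p ^ r \<le> cmod \<beta>"
    using bias p0 by (simp add: \<beta>_def norm_divide norm_power field_simps)
  have \<beta>s: "(\<Sum>x\<in>?X. character p (R x)) = of_nat (p ^ n) * \<beta>" using p0 by (simp add: \<beta>_def)
  \<comment> \<open>With \<eta> = p^-(r+3) as below, Chebyshev's inequality bounds the density of B
    by 4 p^(2r+6-c), and 4 \<le> p^2 turns this into p^-t.\<close>
  define c where "c = 2 * r + t + 8"
  obtain Z D where D: "D \<subseteq> RM p n (e - 1)" "card D < Suc e ^ c"
    and Z: "(\<Sum>x\<in>?X. (cmod (Z x - \<beta>))\<^sup>2) \<le> 4 * ?N / real p ^ c"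
    and det: "\<And>x z. x \<in> ?X \<Longrightarrow> z \<in> ?X \<Longrightarrow> agree D x z \<Longrightarrow>
       Z x * cnj (character p (R x)) = Z z * cnj (character p (R z))"
    using low_variance_average[OF p R assms(3) \<beta>s \<beta>1, of c] by blast
  \<comment> \<open>Small enough for 2 p \<eta> + \<eta> \<le> p^3 \<eta> = p^-r, which is a lower
    bound for the modulus of \<beta>.\<close>
  define \<eta> where "\<eta> = 1 / real p ^ (r + 3)"
  define B where "B = {x \<in> ?X. \<eta> \<le> cmod (Z x - \<beta>)}"
  have \<eta>0: "\<eta> > 0" using p0 by (simp add: \<eta>_def)
  have "card B * \<eta>\<^sup>2 = (\<Sum>x\<in>B. \<eta>\<^sup>2)" by simp
  also have "\<dots> \<le> (\<Sum>x\<in>B. (cmod (Z x - \<beta>))\<^sup>2)"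
    using \<eta>0 by (intro sum_mono power_mono) (auto simp: B_def)
  also have "\<dots> \<le> (\<Sum>x\<in>?X. (cmod (Z x - \<beta>))\<^sup>2)"
    by (rule sum_mono2) (auto simp: B_def finite_points)
  also have "\<dots> \<le> (real p)\<^sup>2 * ?N / real p ^ c"
  proof -
    have "(2::real)\<^sup>2 \<le> (real p)\<^sup>2" using p2 by (intro power_mono) auto
    then have "4 * ?N / real p ^ c \<le> (real p)\<^sup>2 * ?N / real p ^ c"
      by (intro divide_right_mono mult_right_mono) auto
    then show ?thesis using Z by linarith
  qed
  also have "\<dots> = ?N / real p ^ t * \<eta>\<^sup>2"
  proof -
    have "real p ^ c = (real p)\<^sup>2 * real p ^ t * (real p ^ (r + 3))\<^sup>2"
      by (simp add: c_def power_add power_mult power2_eq_square mult_ac numeral_eq_Suc power_mult_distrib)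
    then show ?thesis using p0 by (simp add: \<eta>_def power_divide)
  qed
  finally have cardB: "real (card B) \<le> ?N / real p ^ t"
    by (rule mult_right_le_imp_le) (use \<eta>0 in simp)
  have "R x = R z" if x: "x \<in> ?X - B" and z: "z \<in> ?X - B" and agr: "agree D x z" for x z
  \<comment> \<open>If R x and R z differed, then Z x and Z z would differ by at least |Z z| / p.
    Off B both are within \<eta> of \<beta>, so |Z z|, and with it the modulus of \<beta>, would be
    too small.\<close>
  proof (rule ccontr)
    assume "R x \<noteq> R z"
    then have "\<not> int p dvd R x - R z" using eq_of_mod_eq RM_range[OF R] x z by blast
    then have sep: "1 / real p \<le> cmod (character p (R x - R z) - 1)"
      by (rule character_separated[OF p0])
    have Zx: "cmod (Z x - \<beta>) < \<eta>" and Zz: "cmod (Z z - \<beta>) < \<eta>" using x z by (auto simp: B_def)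
    have "Z x * cnj (character p (R x)) = Z z * cnj (character p (R z))" using det x z agr by blast
    then have "Z x * (character p (R x) * cnj (character p (R x))) = Z z * (character p (R x) * cnj (character p (R z)))"
      by (metis mult.assoc mult.commute)
    then have "Z x = Z z * character p (R x - R z)" by (simp add: character_diff)
    then have "Z x - Z z = Z z * (character p (R x - R z) - 1)" by (simp add: algebra_simps)
    then have "cmod (Z z) * (1 / real p) \<le> cmod (Z x - Z z)"
      using sep by (simp only: norm_mult) (intro mult_left_mono, auto)
    also have "cmod (Z x - Z z) < 2 * \<eta>"
      using norm_triangle_ineq4[of "Z x - \<beta>" "Z z - \<beta>"] Zx Zz by simp
    finally have "cmod (Z z) < 2 * \<eta> * real p" using p0 by (simp add: field_simps)
    moreover have "cmod \<beta> \<le> cmod (Z z) + cmod (Z z - \<beta>)" by (metis norm_triangle_sub norm_minus_commute)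
    ultimately have "1 / real p ^ r < 2 * \<eta> * real p + \<eta>" using \<beta>r Zz by linarith
    also have "\<dots> \<le> 4 * real p * \<eta>" using p2 \<eta>0 by (simp add: field_simps)
    also have "\<dots> \<le> real p ^ 3 * \<eta>"
    proof -
      have "(2::real)\<^sup>2 \<le> (real p)\<^sup>2" using p2 by (intro power_mono) auto
      then have "4 * real p \<le> (real p)\<^sup>2 * real p" by (intro mult_right_mono) auto
      then show ?thesis using \<eta>0 by (intro mult_right_mono) (auto simp: power2_eq_square power3_eq_cube)
    qed
    also have "\<dots> = 1 / real p ^ r" using p0 by (simp add: \<eta>_def power_add)
    finally show False by simp
  qed
  then show ?thesis
    using cardB D by (intro that[of B D]) (auto simp: B_def c_def)
qed

subsection \<open>Discrepancy\<close>

text \<open>The guard mirrors the inner sum over \<open>GFp p\<close>, which has no nonzero term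
  when f x is not a residue; the functions of the induction are arbitrary and may take such
  values.\<close>

definition defect :: "nat \<Rightarrow> nat \<Rightarrow> ((nat \<Rightarrow> int) \<Rightarrow> int \<Rightarrow> real) \<Rightarrow> pfun set \<Rightarrow> pfun \<Rightarrow> (nat \<Rightarrow> int) \<Rightarrow> real" where
  "defect p n \<phi> H f x = (if f x \<in> GFp p then \<phi> x (f x) - cond_avg p n \<phi> H x (f x) else 0)"

definition discrepancy :: "nat \<Rightarrow> nat \<Rightarrow> ((nat \<Rightarrow> int) \<Rightarrow> int \<Rightarrow> real) \<Rightarrow> pfun set \<Rightarrow> pfun \<Rightarrow> real" where
  "discrepancy p n \<phi> H f = avg_inner p n (unit_at f) \<phi> - avg_inner p n (unit_at f) (cond_avg p n \<phi> H)"

lemma discrepancy_eq: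
  "discrepancy p n \<phi> H f = (\<Sum>x\<in>points p n. defect p n \<phi> H f x) / real (p ^ n)"
proof -
  have "(\<Sum>y\<in>GFp p. unit_at f x y * \<psi> y) = (if f x \<in> GFp p then \<psi> (f x) else 0)" for \<psi> x
  proof -
    have "(\<Sum>y\<in>GFp p. unit_at f x y * \<psi> y) = (\<Sum>y\<in>GFp p. if y = f x then \<psi> y else 0)"
      by (rule sum.cong) (simp_all add: unit_at_def)
    then show ?thesis by (simp add: finite_GFp)
  qed
  moreover have "(if P then a else 0) - (if P then b else 0) = (if P then a - b else 0)" for P and a b :: real
    by simp
  ultimately show ?thesis
    by (simp only: discrepancy_def avg_inner_def defect_def card_points sum_subtractf[symmetric]
        diff_divide_distrib[symmetric])
qed

lemma simplex_difference_bounded: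
  assumes \<phi>: "\<And>x. x \<in> points p n \<Longrightarrow> \<phi> x \<in> prob_simplex p" and x: "x \<in> points p n" and y: "y \<in> GFp p"
  shows "\<bar>\<phi> x y - cond_avg p n \<phi> H x y\<bar> \<le> 1"
proof -
  have bd: "0 \<le> \<phi> z y" "\<phi> z y \<le> 1" if "z \<in> points p n" for z
  proof -
    have v: "\<forall>y\<in>GFp p. 0 \<le> \<phi> z y" "(\<Sum>y\<in>GFp p. \<phi> z y) = 1"
      using \<phi>[OF that] by (auto simp: prob_simplex_def)
    show "0 \<le> \<phi> z y" using v(1) y by blast
    show "\<phi> z y \<le> 1" using member_le_sum[of y "GFp p" "\<phi> z"] v y finite_GFp by auto
  qed
  have sub: "atom p n H x \<subseteq> points p n" by (auto simp: atom_def)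
  then have "finite (atom p n H x)" "x \<in> atom p n H x" using finite_points finite_subset x by (auto simp: atom_def)
  then have pos: "real (card (atom p n H x)) > 0" by (auto simp: card_gt_0_iff)
  have "0 \<le> (\<Sum>z\<in>atom p n H x. \<phi> z y)" using bd sub by (intro sum_nonneg) auto
  moreover have "(\<Sum>z\<in>atom p n H x. \<phi> z y) \<le> real (card (atom p n H x)) * 1"
    using bd sub by (intro sum_bounded_above) auto
  ultimately have "0 \<le> cond_avg p n \<phi> H x y" "cond_avg p n \<phi> H x y \<le> 1"
    using pos by (auto simp: cond_avg_def)
  then show ?thesis using bd[OF x] by auto
qed

text \<open>A nonempty fibre is the atom of each of its points, so on it the conditional average is
  constantly the mean of \<phi> over the fibre.\<close>

lemma sum_fibre_eq_0:
  "(\<Sum>x\<in>points p n. if \<forall>h\<in>S. h x = u h then \<phi> x y - cond_avg p n \<phi> S x y else 0) = 0"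
proof -
  define F where "F = {x \<in> points p n. \<forall>h\<in>S. h x = u h}"
  have finF: "finite F" by (simp add: F_def finite_points)
  have "atom p n S x = F" if "x \<in> F" for x
    using that by (auto simp: atom_def F_def)
  then have avg: "cond_avg p n \<phi> S x y = (\<Sum>z\<in>F. \<phi> z y) / real (card F)" if "x \<in> F" for x
    using that by (simp add: cond_avg_def)
  have "(\<Sum>x\<in>points p n. if \<forall>h\<in>S. h x = u h then \<phi> x y - cond_avg p n \<phi> S x y else 0)
    = (\<Sum>x\<in>F. \<phi> x y - cond_avg p n \<phi> S x y)"
    unfolding F_def by (rule sum.mono_neutral_cong_right) (auto simp: finite_points)
  also have "\<dots> = (\<Sum>x\<in>F. \<phi> x y) - real (card F) * ((\<Sum>z\<in>F. \<phi> z y) / real (card F))"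
    using avg by (simp add: sum_subtractf)
  also have "\<dots> = 0" using finF by (cases "F = {}") simp_all
  finally show ?thesis .
qed

definition determined :: "nat \<Rightarrow> nat \<Rightarrow> pfun set \<Rightarrow> pfun \<Rightarrow> bool" where
  "determined p n H f \<longleftrightarrow> (\<forall>x\<in>points p n. \<forall>z\<in>points p n. agree H x z \<longrightarrow> f x = f z)"

text \<open>The frequency b cannot vanish since the conditional expectation on S removes all correlation
  with functions of S alone.\<close>

lemma correlating_combination:
  assumes p: "prime p" and \<phi>: "\<And>x. x \<in> points p n \<Longrightarrow> \<phi> x \<in> prob_simplex p"
    and fin: "finite S" "finite T" and card: "card S + card T \<le> k"
    and range: "\<forall>h\<in>S \<union> T. \<forall>x\<in>points p n. h x \<in> GFp p"
    and f: "determined p n (S \<union> T) f"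
    and large: "1 / real p ^ s < \<bar>discrepancy p n \<phi> S f\<bar>"
  shows "\<exists>y\<in>GFp p. \<exists>u\<in>S \<rightarrow>\<^sub>E GFp p. \<exists>b. (\<exists>g\<in>T. \<not> int p dvd b g) \<and>
    real (p ^ n) / real p ^ (s + k) \<le> cmod (\<Sum>x\<in>points p n.
      (if \<forall>h\<in>S. h x = u h then complex_of_real (\<phi> x y - cond_avg p n \<phi> S x y) else 0)
        * character p (\<Sum>g\<in>T. b g * g x))"
proof -
  let ?X = "points p n" and ?W = "(S \<union> T) \<rightarrow>\<^sub>E GFp p"
  have p0: "p > 0" using p prime_gt_0_nat by blast
  \<comment> \<open>There are at most p^k value vectors on \<open>S \<union> T\<close>, so some
    fibre carries at least the share p^-k of a total defect larger than p^(n-s).\<close>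
  define \<rho> where "\<rho> = real (p ^ n) / real p ^ (s + k)"
  have \<rho>0: "\<rho> > 0" using p0 by (simp add: \<rho>_def)
  define A where "A w = (\<Sum>x\<in>?X. if \<forall>h\<in>S \<union> T. h x = w h then defect p n \<phi> S f x else 0)" for w
  have finW: "finite ?W" using fin by (intro finite_PiE) (auto simp: finite_GFp)
  have "(\<Sum>w\<in>?W. if \<forall>h\<in>S \<union> T. h x = w h then c else 0) = c" if x: "x \<in> ?X" for x and c :: real
  proof -
    let ?w = "\<lambda>h\<in>S \<union> T. h x"
    have w: "?w \<in> ?W" using range x by auto
    have "(\<forall>h\<in>S \<union> T. h x = w h) \<longleftrightarrow> w = ?w" if "w \<in> ?W" for w
      using that by (auto simp: fun_eq_iff PiE_iff extensional_def)
    then have "(\<Sum>w\<in>?W. if \<forall>h\<in>S \<union> T. h x = w h then c else 0) = (\<Sum>w\<in>?W. if w = ?w then c else 0)"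
      by (intro sum.cong refl) presburger
    also have "\<dots> = c" using w finW by (simp only: sum.delta if_True)
    finally show ?thesis .
  qed
  then have "(\<Sum>x\<in>?X. defect p n \<phi> S f x) = (\<Sum>w\<in>?W. A w)"
    unfolding A_def by (subst sum.swap) simp
  then have "\<bar>\<Sum>x\<in>?X. defect p n \<phi> S f x\<bar> \<le> (\<Sum>w\<in>?W. \<bar>A w\<bar>)" by (simp add: sum_abs)
  moreover have "real (p ^ n) / real p ^ s < \<bar>\<Sum>x\<in>?X. defect p n \<phi> S f x\<bar>"
    using large p0 by (simp add: discrepancy_eq field_simps)
  moreover have "real (card ?W) * \<rho> \<le> real (p ^ n) / real p ^ s"
  proof -
    have "card ?W = p ^ card (S \<union> T)" using fin by (simp add: card_PiE card_GFp)
    also have "\<dots> \<le> p ^ k" using card card_Un_le[of S T] p0 by (intro power_increasing) linarith+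
    finally have "real (card ?W) \<le> real p ^ k" by (metis of_nat_le_iff of_nat_power)
    then have "real (card ?W) * \<rho> \<le> real p ^ k * \<rho>" using \<rho>0 by (intro mult_right_mono) auto
    also have "\<dots> = real (p ^ n) / real p ^ s" using p0 by (simp add: \<rho>_def power_add)
    finally show ?thesis .
  qed
  ultimately have "real (card ?W) * \<rho> < (\<Sum>w\<in>?W. \<bar>A w\<bar>)" by linarith
  moreover have "(\<Sum>w\<in>?W. \<bar>A w\<bar>) \<le> real (card ?W) * \<rho>" if "\<And>w. w \<in> ?W \<Longrightarrow> \<bar>A w\<bar> \<le> \<rho>"
    using that by (rule sum_bounded_above)
  ultimately obtain w where w: "w \<in> ?W" "\<rho> < \<bar>A w\<bar>" by (meson not_le)
  \<comment> \<open>A point of nonzero defect guarantees that the common value y of f on the fibre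
    is a residue, so that y is one of only p candidates.\<close>
  have "\<exists>x\<in>?X. (if \<forall>h\<in>S \<union> T. h x = w h then defect p n \<phi> S f x else 0) \<noteq> 0"
  proof (rule ccontr)
    assume "\<not> ?thesis"
    then have "A w = 0" unfolding A_def by (intro sum.neutral) blast
    then show False using w \<rho>0 by simp
  qed
  then obtain x0 where x0: "x0 \<in> ?X" "\<forall>h\<in>S \<union> T. h x0 = w h" "defect p n \<phi> S f x0 \<noteq> 0"
    by (auto split: if_splits)
  define y where "y = f x0"
  have y: "y \<in> GFp p" using x0(3) by (auto simp: defect_def y_def split: if_splits)
  have fy: "f x = y" if "x \<in> ?X" "\<forall>h\<in>S \<union> T. h x = w h" for x
    using f that x0 unfolding determined_def agree_def y_def by metis
  define u where "u = restrict w S"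
  have u: "u \<in> S \<rightarrow>\<^sub>E GFp p" using w(1) by (auto simp: u_def)
  define G where "G x = (if \<forall>h\<in>S. h x = u h then complex_of_real (\<phi> x y - cond_avg p n \<phi> S x y) else 0)" for x
  have "complex_of_real (A w) = (\<Sum>x\<in>?X. if \<forall>g\<in>T. g x = w g then G x else 0)"
    unfolding A_def of_real_sum
  proof (rule sum.cong[OF refl])
    fix x assume x: "x \<in> ?X"
    show "complex_of_real (if \<forall>h\<in>S \<union> T. h x = w h then defect p n \<phi> S f x else 0)
      = (if \<forall>g\<in>T. g x = w g then G x else 0)"
    proof (cases "\<forall>h\<in>S \<union> T. h x = w h")
      case True
      then show ?thesis using fy[OF x True] y by (simp add: G_def u_def defect_def)
    next
      case False
      then show ?thesis by (auto simp: G_def u_def)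
    qed
  qed
  then have "\<rho> \<le> cmod (\<Sum>x\<in>?X. if \<forall>g\<in>T. g x = w g then G x else 0)"
    using w(2) by (metis less_imp_le norm_of_real)
  then obtain b where b: "\<rho> \<le> cmod (\<Sum>x\<in>?X. G x * character p (\<Sum>g\<in>T. b g * g x))"
    using character_correlation_of_fibre[OF p0 fin(2), of n w \<rho> G] range w(1) by (auto simp: PiE_iff)
  have "\<exists>g\<in>T. \<not> int p dvd b g"
  proof (rule ccontr)
    assume "\<not> ?thesis"
    then have "int p dvd (\<Sum>g\<in>T. b g * g x)" for x by (intro dvd_sum) auto
    then have "character p (\<Sum>g\<in>T. b g * g x) = 1" for x
      using character_multiple[OF p0] by (metis dvd_def)
    then have "(\<Sum>x\<in>?X. G x * character p (\<Sum>g\<in>T. b g * g x)) = (\<Sum>x\<in>?X. G x)" by simp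
    also have "\<dots> = complex_of_real (\<Sum>x\<in>?X. if \<forall>h\<in>S. h x = u h then \<phi> x y - cond_avg p n \<phi> S x y else 0)"
      unfolding of_real_sum by (intro sum.cong refl) (simp add: G_def)
    also have "\<dots> = 0" by (simp only: sum_fibre_eq_0 of_real_0)
    finally show False using b \<rho>0 by simp
  qed
  then show ?thesis using b u y unfolding G_def \<rho>_def
    by (intro bexI[of _ y] bexI[of _ u] exI[of _ b] conjI)
qed

text \<open>Every defect lies between -1 and 1, whatever H is, so an exceptional point changes the
  sum by at most 2.\<close>

lemma discrepancy_perturb:
  assumes "p > 0" and \<phi>: "\<And>x. x \<in> points p n \<Longrightarrow> \<phi> x \<in> prob_simplex p"
    and B: "B \<subseteq> points p n" "real (card B) \<le> real (p ^ n) / real p ^ t"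
    and eq: "\<And>x. x \<in> points p n - B \<Longrightarrow> f x = f' x"
  shows "\<bar>discrepancy p n \<phi> H f\<bar> \<le> \<bar>discrepancy p n \<phi> H f'\<bar> + 2 / real p ^ t"
proof -
  let ?X = "points p n"
  have bd: "\<bar>defect p n \<phi> H f x\<bar> \<le> 1" if x: "x \<in> ?X" for f x
    using simplex_difference_bounded[where \<phi> = \<phi> and y = "f x" and H = H, OF \<phi> x]
    by (simp add: defect_def)
  have "\<bar>(\<Sum>x\<in>?X. defect p n \<phi> H f x) - (\<Sum>x\<in>?X. defect p n \<phi> H f' x)\<bar>
    = \<bar>\<Sum>x\<in>B. defect p n \<phi> H f x - defect p n \<phi> H f' x\<bar>"
    unfolding sum_subtractf[symmetric]
    by (intro arg_cong[of _ _ abs] sum.mono_neutral_right) (use B eq in \<open>auto simp: finite_points defect_def\<close>)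
  also have "\<dots> \<le> (\<Sum>x\<in>B. 2)"
  proof (rule order_trans[OF sum_abs sum_mono])
    fix x assume "x \<in> B"
    then have "x \<in> ?X" using B by blast
    then show "\<bar>defect p n \<phi> H f x - defect p n \<phi> H f' x\<bar> \<le> 2"
      using bd[of x f] bd[of x f'] by linarith
  qed
  also have "\<dots> \<le> real (p ^ n) * (2 / real p ^ t)" using mult_right_mono[OF B(2), of 2] by simp
  finally have "\<bar>discrepancy p n \<phi> H f - discrepancy p n \<phi> H f'\<bar> \<le> 2 / real p ^ t"
    using assms(1) by (simp add: discrepancy_eq field_simps flip: diff_divide_distrib)
  then show ?thesis by linarith
qed

subsection \<open>Trading a polynomial for polynomials of lower degree\<close>

text \<open>The second component of a pair is only an upper bound for the degree of the first one.\<close>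

definition typed :: "nat \<Rightarrow> nat \<Rightarrow> (pfun \<times> nat) multiset \<Rightarrow> bool" where
  "typed p n W \<longleftrightarrow> (\<forall>(g, e)\<in>#W. g \<in> RM p n e)"

text \<open>Take the largest recorded degree among the entries whose coefficient survives modulo p.
  The entry to be traded must carry a degree that bounds all of P, since this recorded degree, not
  the true one, is what the induction decreases.\<close>

lemma exists_leading_polynomial:
  assumes "p > 0" and W: "typed p n W" and b: "\<exists>g\<in>fst ` set_mset W. \<not> int p dvd b g"
  shows "\<exists>g e. (g, e) \<in># W \<and> \<not> int p dvd b g \<and>
    (\<lambda>x\<in>points p n. (\<Sum>h\<in>fst ` set_mset W. b h * h x) mod int p) \<in> RM p n e"
proof -
  let ?E = "snd ` {q \<in> set_mset W. \<not> int p dvd b (fst q)}"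
  have "finite ?E" "?E \<noteq> {}" using b by auto
  then have "Max ?E \<in> ?E" and max: "\<And>e. e \<in> ?E \<Longrightarrow> e \<le> Max ?E" by (rule Max_in) (auto intro: Max_ge)
  then obtain g where g: "(g, Max ?E) \<in># W" "\<not> int p dvd b g" by auto
  have "h \<in> RM p n (Max ?E)" if h: "h \<in> fst ` set_mset W" "\<not> int p dvd b h" for h
  proof -
    obtain e where e: "(h, e) \<in># W" using h(1) by auto
    then have "e \<le> Max ?E" using h(2) by (intro max) force
    moreover have "h \<in> RM p n e" using W e by (auto simp: typed_def)
    ultimately show ?thesis using RM_mono by blast
  qed
  then have "(\<lambda>x\<in>points p n. (\<Sum>h\<in>fst ` set_mset W. b h * h x) mod int p) \<in> RM p n (Max ?E)"
    using assms(1) by (rule RM_linear_combination)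
  then show ?thesis using g by blast
qed

lemma in_diff_single: "q \<in># W \<Longrightarrow> q \<noteq> q' \<Longrightarrow> q \<in># W - {#q'#}"
  by (simp add: in_diff_count)

text \<open>Off B, the values of Q and D determine P. The remaining entries determine all other
  terms of the combination, hence also b g times g, and thus g because b g is invertible modulo p.
  So f is determined off B without the entry g.\<close>

lemma trade_polynomial:
  assumes p: "prime p" and W: "typed p n W" and f: "determined p n (S \<union> fst ` set_mset W) f"
    and g: "(g, e) \<in># W" "\<not> int p dvd b g" and "e \<ge> 1"
    and P: "P = (\<lambda>x\<in>points p n. (\<Sum>h\<in>fst ` set_mset W. b h * h x) mod int p)" "P \<in> RM p n e"
    and Q: "Q \<in> RM p n e"
    and bias: "real (p ^ n) / real p ^ r \<le> cmod (\<Sum>x\<in>points p n. character p (P x - Q x))"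
  shows "\<exists>W' f' l B. typed p n W' \<and> l < Suc e ^ (2 * r + t + 8) \<and>
    image_mset snd W' = image_mset snd W - {#e#} + replicate_mset l (e - 1) \<and>
    determined p n (insert Q S \<union> fst ` set_mset W') f' \<and>
    B \<subseteq> points p n \<and> real (card B) \<le> real (p ^ n) / real p ^ t \<and> (\<forall>x\<in>points p n - B. f x = f' x)"
proof -
  let ?X = "points p n" and ?T = "fst ` set_mset W"
  have p0: "p > 0" using p prime_gt_0_nat by blast
  define R where "R = (\<lambda>x\<in>?X. (P x - Q x) mod int p)"
  have RRM: "R \<in> RM p n e" unfolding R_def using P(2) Q p0 by (rule RM_diff)
  have "(\<Sum>x\<in>?X. character p (P x - Q x)) = (\<Sum>x\<in>?X. character p (R x))"
    by (rule sum.cong) (simp_all add: R_def character_mod[OF p0])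
  then have bias': "real (p ^ n) / real p ^ r \<le> cmod (\<Sum>x\<in>?X. character p (R x))"
    using bias by simp
  obtain B D where B: "B \<subseteq> ?X" "real (card B) \<le> real (p ^ n) / real p ^ t"
    and D: "D \<subseteq> RM p n (e - 1)" "card D < Suc e ^ (2 * r + t + 8)"
    and R: "\<And>x z. x \<in> ?X - B \<Longrightarrow> z \<in> ?X - B \<Longrightarrow> agree D x z \<Longrightarrow> R x = R z"
    by (rule biased_polynomial_structure[OF p RRM \<open>e \<ge> 1\<close> bias', of t]) (rule that)
  have finD: "finite D" using D(1) finite_RM finite_subset by blast
  define W' where "W' = W - {#(g, e)#} + image_mset (\<lambda>h. (h, e - 1)) (mset_set D)"
  have setW': "fst ` set_mset W' = fst ` set_mset (W - {#(g, e)#}) \<union> D"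
    using finD by (auto simp: W'_def image_Un image_image)
  have "typed p n W'"
    using W D(1) finD by (auto simp: typed_def W'_def dest!: in_diffD)
  moreover have "image_mset snd W' = image_mset snd W - {#e#} + replicate_mset (card D) (e - 1)"
  proof -
    obtain V where "W = add_mset (g, e) V" using multi_member_split[OF g(1)] by blast
    then show ?thesis
      by (simp add: W'_def multiset.map_comp comp_def image_mset_const_eq)
  qed
  moreover define H where "H = insert Q S \<union> fst ` set_mset W'"
  have fH: "f x = f z" if x: "x \<in> ?X - B" and z: "z \<in> ?X - B" and agr: "agree H x z" for x z
  proof -
    have "R x = R z" using R[OF x z] agr by (auto simp: agree_def H_def setW')
    then have "int p dvd (P x - Q x) - (P z - Q z)"
      using x z by (simp add: R_def mod_eq_dvd_iff)
    moreover have "Q x = Q z" using agr by (simp add: agree_def H_def)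
    ultimately have "int p dvd P x - P z" by simp
    then have "int p dvd (\<Sum>h\<in>?T. b h * h x) - (\<Sum>h\<in>?T. b h * h z)"
      using x z by (simp add: P(1) mod_eq_dvd_iff[symmetric])
    also have "(\<Sum>h\<in>?T. b h * h x) - (\<Sum>h\<in>?T. b h * h z) = (\<Sum>h\<in>?T. b h * (h x - h z))"
      by (simp add: right_diff_distrib sum_subtractf)
    also have "\<dots> = b g * (g x - g z) + (\<Sum>h\<in>?T - {g}. b h * (h x - h z))"
      using g(1) by (intro sum.remove) force+
    also have "(\<Sum>h\<in>?T - {g}. b h * (h x - h z)) = 0"
    proof (rule sum.neutral, rule ballI)
      fix h assume "h \<in> ?T - {g}"
      then obtain e' where "(h, e') \<in># W" "(h, e') \<noteq> (g, e)" by auto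
      then have "(h, e') \<in># W - {#(g, e)#}" by (rule in_diff_single)
      then have "h \<in> H" unfolding H_def setW' by force
      then show "b h * (h x - h z) = 0" using agr by (simp add: agree_def)
    qed
    finally have "int p dvd g x - g z" using p g(2) by (simp add: prime_dvd_mult_iff)
    moreover have "g \<in> RM p n e" using W g(1) by (auto simp: typed_def)
    ultimately have gg: "g x = g z" using x z RM_range eq_of_mod_eq by blast
    have "h x = h z" if h: "h \<in> S \<union> ?T" for h
    proof (cases "h \<in> S \<or> h = g")
      case True
      then show ?thesis using gg agr by (auto simp: agree_def H_def)
    next
      case False
      then obtain e' where "(h, e') \<in># W" "(h, e') \<noteq> (g, e)" using h by auto
      then have "(h, e') \<in># W - {#(g, e)#}" by (rule in_diff_single)
      then have "h \<in> H" unfolding H_def setW' by force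
      then show ?thesis using agr by (simp add: agree_def)
    qed
    then have "agree (S \<union> ?T) x z" by (simp add: agree_def)
    then show ?thesis using f x z by (auto simp: determined_def)
  qed
  \<comment> \<open>To be determined everywhere, f' copies f from a representative off B in the same
    class of \<open>agree H\<close>; the value 0 is used on classes contained in B.\<close>
  define f' where "f' x = (if \<exists>z\<in>?X - B. agree H x z then f (SOME z. z \<in> ?X - B \<and> agree H x z) else 0)" for x
  have "determined p n H f'"
    unfolding determined_def
  proof (intro ballI impI)
    fix x z assume "agree H x z"
    then have "agree H x v = agree H z v" for v unfolding agree_def by metis
    then show "f' x = f' z" by (simp add: f'_def)
  qed
  moreover have "f x = f' x" if x: "x \<in> ?X - B" for x
  proof -
    have ex: "x \<in> ?X - B \<and> agree H x x" using x by (simp add: agree_def)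
    define v where "v = (SOME z. z \<in> ?X - B \<and> agree H x z)"
    have "v \<in> ?X - B \<and> agree H x v"
      unfolding v_def by (rule someI[of "\<lambda>z. z \<in> ?X - B \<and> agree H x z", OF ex])
    then have "f x = f v" using fH[OF x] by blast
    then show ?thesis using ex by (auto simp: f'_def v_def)
  qed
  ultimately show ?thesis using D(2) B unfolding H_def by blast
qed

section \<open>Uniform approximability and the induction over multisets of degrees\<close>

definition approximating_family ::
    "nat \<Rightarrow> nat \<Rightarrow> nat \<Rightarrow> nat multiset \<Rightarrow> nat \<Rightarrow> nat \<Rightarrow> pfun set \<Rightarrow> ((nat \<Rightarrow> int) \<Rightarrow> int \<Rightarrow> real) \<Rightarrow> pfun set set \<Rightarrow> bool"
where
  "approximating_family p n D M s c S \<phi> \<G> \<longleftrightarrow>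
    finite \<G> \<and> card \<G> \<le> p ^ c \<and> (\<forall>H\<in>\<G>. H \<subseteq> RM p n D \<and> card H \<le> c) \<and>
    (\<forall>f W. image_mset snd W = M \<longrightarrow> typed p n W \<longrightarrow> determined p n (S \<union> fst ` set_mset W) f \<longrightarrow>
      (\<exists>H\<in>\<G>. \<bar>discrepancy p n \<phi> H f\<bar> \<le> 1 / real p ^ s))"

text \<open>The constant c precedes p, n, S and \<phi>. The size of S is only bounded by m because
  adding Q may leave S unchanged.\<close>

definition approximable :: "nat \<Rightarrow> nat multiset \<Rightarrow> nat \<Rightarrow> nat \<Rightarrow> nat \<Rightarrow> bool" where
  "approximable D M s m c \<longleftrightarrow> (\<forall>p n S \<phi>. prime p \<longrightarrow> S \<subseteq> RM p n D \<longrightarrow> card S \<le> m \<longrightarrow>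
    (\<forall>x\<in>points p n. \<phi> x \<in> prob_simplex p) \<longrightarrow> (\<exists>\<G>. approximating_family p n D M s c S \<phi> \<G>))"

lemma approximable_mono:
  assumes "approximable D M s m c" "c \<le> c'"
  shows "approximable D M s m c'"
proof -
  have "approximating_family p n D M s c' S \<phi> \<G>"
    if "prime p" "approximating_family p n D M s c S \<phi> \<G>" for p n S \<phi> \<G>
  proof -
    have "p ^ c \<le> p ^ c'" using assms(2) prime_gt_0_nat[OF that(1)] by (intro power_increasing) auto
    then have "card \<G> \<le> p ^ c'" using that(2) by (auto simp: approximating_family_def)
    moreover have "\<forall>H\<in>\<G>. H \<subseteq> RM p n D \<and> card H \<le> c'"
      using that(2) assms(2) by (force simp: approximating_family_def)
    ultimately show ?thesis using that(2) unfolding approximating_family_def by blast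
  qed
  then show ?thesis using assms(1) unfolding approximable_def by metis
qed

lemma approximable_remove_constant:
  assumes A: "approximable D (M - {#0#}) s m c" and "0 \<in># M"
  shows "approximable D M s m c"
proof -
  have *: "\<exists>W'. image_mset snd W' = M - {#0#} \<and> typed p n W' \<and> determined p n (S \<union> fst ` set_mset W') f"
    if W: "image_mset snd W = M" "typed p n W" "determined p n (S \<union> fst ` set_mset W) f" for p n S W f
  proof -
    have "0 \<in># image_mset snd W" using W(1) assms(2) by simp
    then obtain g where g: "(g, 0) \<in># W" by auto
    let ?W = "W - {#(g, 0)#}"
    have g0: "g \<in> RM p n 0" using W(2) g by (auto simp: typed_def)
    have "determined p n (S \<union> fst ` set_mset ?W) f"
      unfolding determined_def
    proof (intro ballI impI)
      fix x z assume xz: "x \<in> points p n" "z \<in> points p n" "agree (S \<union> fst ` set_mset ?W) x z"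
      have "h x = h z" if h: "h \<in> S \<union> fst ` set_mset W" for h
      proof (cases "h = g")
        case True
        then show ?thesis using RM_degree_0[OF g0 xz(1,2)] by simp
      next
        case False
        have "h \<in> S \<union> fst ` set_mset ?W"
        proof (cases "h \<in> S")
          case notS: False
          then obtain e where "(h, e) \<in># W" using h by auto
          then have "(h, e) \<in># ?W" using False by (intro in_diff_single) auto
          then show ?thesis by force
        qed simp
        then show ?thesis using xz(3) by (simp add: agree_def)
      qed
      then have "agree (S \<union> fst ` set_mset W) x z" unfolding agree_def by blast
      then show "f x = f z" using W(3) xz(1,2) unfolding determined_def by blast
    qed
    moreover have "image_mset snd ?W = M - {#0#}" using W(1) g by (simp add: image_mset_Diff)
    moreover have "typed p n ?W" using W(2) by (auto simp: typed_def dest: in_diffD)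
    ultimately show ?thesis by blast
  qed
  have "approximating_family p n D M s c S \<phi> \<G>"
    if \<G>: "approximating_family p n D (M - {#0#}) s c S \<phi> \<G>" for p n S \<phi> \<G>
  proof -
    have "\<exists>H\<in>\<G>. \<bar>discrepancy p n \<phi> H f\<bar> \<le> 1 / real p ^ s"
      if "image_mset snd W = M" "typed p n W" "determined p n (S \<union> fst ` set_mset W) f" for f W
      using *[OF that] \<G> unfolding approximating_family_def by blast
    then show ?thesis using \<G> unfolding approximating_family_def by blast
  qed
  then show ?thesis using A unfolding approximable_def by metis
qed

lemma card_UN_power:
  assumes "finite I" "card I \<le> p ^ a" "\<And>i. i \<in> I \<Longrightarrow> finite (F i)" "\<And>i. i \<in> I \<Longrightarrow> card (F i) \<le> (p::nat) ^ b"
  shows "card (\<Union>i\<in>I. F i) \<le> p ^ (a + b)"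
proof -
  have "card (\<Union>i\<in>I. F i) \<le> (\<Sum>i\<in>I. card (F i))" using assms(1) by (rule card_UN_le)
  also have "\<dots> \<le> card I * p ^ b" using sum_bounded_above[of I "\<lambda>i. card (F i)" "p ^ b"] assms(4) by simp
  also have "\<dots> \<le> p ^ a * p ^ b" using assms(2) by (rule mult_right_mono) simp
  finally show ?thesis by (simp add: power_add)
qed

lemma card_set_mset_le_size: "card (set_mset W) \<le> size W"
  by (induction W) (simp_all add: card_insert_if)

lemma mult1_replace:
  assumes "a \<in># M" "\<And>b. b \<in># K \<Longrightarrow> b < a"
  shows "(M - {#a#} + K, M) \<in> mult1 {(x, y). x < y}"
proof -
  obtain N where "M = add_mset a N" using multi_member_split[OF assms(1)] by blast
  then show ?thesis using assms(2) by (auto simp: mult1_def)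
qed

text \<open>A trade replaces one entry e by some number of entries e - 1, a single step down in
  \<open>mult1\<close>. Both s and m are generalised because the hypothesis is applied to s + 1,
  leaving room for the exceptional set, and to m + 1, since Q joins S.\<close>

lemma exists_approximable_constant:
  "(\<And>e. e \<in># M \<Longrightarrow> e \<le> D) \<Longrightarrow> \<exists>c. approximable D M s m c"
proof (induction M arbitrary: s m rule: wf_induct_rule[OF wf_mult1[OF wf_less]])
  case (1 M)
  show ?case
  proof (cases "0 \<in># M")
    case True
    then have "(M - {#0#}, M) \<in> mult1 {(x, y). x < y}"
      using mult1_replace[of 0 M "{#}"] by simp
    moreover have "e \<le> D" if "e \<in># M - {#0#}" for e using 1(2) in_diffD[OF that] by blast
    ultimately obtain c where "approximable D (M - {#0#}) s m c" using 1(1) by blast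
    then show ?thesis using approximable_remove_constant True by blast
  next
    case False
    \<comment> \<open>p^-K is the correlation that \<open>correlating_combination\<close> provides
      for at most m + size M polynomials, and r is the exponent of the bias that
      \<open>large_spectrum_list\<close> makes of it.\<close>
    define K where "K = s + (m + size M)"
    define r where "r = 2 * K + 1"
    \<comment> \<open>The possible outcomes of a trade: the degree e removed and the number of
      entries e - 1 gained, bounded as in \<open>trade_polynomial\<close> with t = s + 2. This set
      does not depend on p or n.\<close>
    define I where "I = (SIGMA e:set_mset M. {..<Suc e ^ (2 * r + (s + 2) + 8)})"
    have finI: "finite I" by (auto simp: I_def)
    define M' where "M' i = M - {#fst i#} + replicate_mset (snd i) (fst i - 1)" for i
    have "\<exists>c. approximable D (M' i) (s + 1) (m + 1) c" if i: "i \<in> I" for i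
    proof (rule 1(1))
      have e: "fst i \<in># M" using i by (auto simp: I_def)
      then have e0: "fst i > 0" using False by (metis gr0I)
      show "(M' i, M) \<in> mult1 {(x, y). x < y}"
        unfolding M'_def using e e0 by (intro mult1_replace) (auto split: if_splits)
      fix e' assume "e' \<in># M' i"
      then show "e' \<le> D" using 1(2) e by (fastforce simp: M'_def split: if_splits dest: in_diffD)
    qed
    then obtain C where C: "\<And>i. i \<in> I \<Longrightarrow> approximable D (M' i) (s + 1) (m + 1) (C i)" by metis
    \<comment> \<open>The sum dominates every \<open>C i\<close> and also makes sense when M, and
      hence I, is empty.\<close>
    define c0 where "c0 = (\<Sum>i\<in>I. C i)"
    have C0: "approximable D (M' i) (s + 1) (m + 1) c0" if "i \<in> I" for i
      using C[OF that] member_le_sum[OF that, of C] finI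
      by (intro approximable_mono[of _ _ _ _ "C i" c0]) (auto simp: c0_def)
    \<comment> \<open>The exponents count, in this order: a factor 2 \<le> p for adding S itself,
      the value y, the value vector u, the outcome i, the candidate Q, and the family for the
      smaller multiset.\<close>
    define c where "c = 1 + (1 + (m + (card I + (r + c0))))"
    have "approximable D M s m c"
      unfolding approximable_def
    proof (intro allI impI)
      fix p n S \<phi>
      assume p: "prime p" and S: "S \<subseteq> RM p n D" "card S \<le> m" and \<phi>: "\<forall>x\<in>points p n. \<phi> x \<in> prob_simplex p"
      have p2: "p \<ge> 2" using p prime_ge_2_nat by blast
      then have p0: "p > 0" by simp
      have \<phi>': "\<phi> x \<in> prob_simplex p" if "x \<in> points p n" for x using \<phi> that by blast
      have finS: "finite S" using S(1) finite_RM finite_subset by blast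
      define w where "w y u x = (if \<forall>h\<in>S. h x = u h then complex_of_real (\<phi> x y - cond_avg p n \<phi> S x y) else 0)"
        for y u x
      define spectrum where "spectrum y u e L \<longleftrightarrow> L \<subseteq> RM p n e \<and> card L \<le> p ^ r \<and> (\<forall>P\<in>RM p n e.
          real (p ^ n) / real p ^ K \<le> cmod (\<Sum>x\<in>points p n. w y u x * character p (P x)) \<longrightarrow>
            (\<exists>Q\<in>L. real (p ^ n) / real p ^ r \<le> cmod (\<Sum>x\<in>points p n. character p (P x - Q x))))"
        for y u e L
      have ex: "\<exists>L. spectrum y u e L"
        if y: "y \<in> GFp p" for y u e
      proof -
        have bound: "cmod (w y u x) \<le> 1" if x: "x \<in> points p n" for x
        proof -
          have "\<bar>\<phi> x y - cond_avg p n \<phi> S x y\<bar> \<le> 1"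
            using \<phi> x y by (intro simplex_difference_bounded) blast+
          then show ?thesis unfolding w_def by (simp del: of_real_diff)
        qed
        obtain L where "L \<subseteq> RM p n e" "card L \<le> p ^ (2 * K + 1)"
          "\<And>P. P \<in> RM p n e \<Longrightarrow>
            real (p ^ n) / real p ^ K \<le> cmod (\<Sum>x\<in>points p n. w y u x * character p (P x)) \<Longrightarrow>
            \<exists>Q\<in>L. real (p ^ n) / real p ^ (2 * K + 1) \<le> cmod (\<Sum>x\<in>points p n. character p (P x - Q x))"
          by (rule large_spectrum_list[where w = "w y u" and n = n and e = e and r = K, OF p2 bound])
            (assumption, rule that)
        then show ?thesis unfolding r_def spectrum_def by (intro exI[of _ L]) blast
      qed
      \<comment> \<open>The choice depends on y, u and e but not on f, so all candidates Q are
        settled before f is given.\<close>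
      define L where "L y u e = (SOME L. spectrum y u e L)" for y u e
      have "spectrum y u e (L y u e)" if "y \<in> GFp p" for y u e
        unfolding L_def using ex[OF that] by (rule someI_ex)
      then have L: "L y u e \<subseteq> RM p n e" "card (L y u e) \<le> p ^ r"
        "\<And>P. P \<in> RM p n e \<Longrightarrow>
          real (p ^ n) / real p ^ K \<le> cmod (\<Sum>x\<in>points p n. w y u x * character p (P x)) \<Longrightarrow>
            \<exists>Q\<in>L y u e. real (p ^ n) / real p ^ r \<le> cmod (\<Sum>x\<in>points p n. character p (P x - Q x))"
        if "y \<in> GFp p" for y u e
        unfolding spectrum_def using that by blast+
      have "\<exists>\<G>. approximating_family p n D (M' i) (s + 1) c0 (insert Q S) \<phi> \<G>"
        if "i \<in> I" "Q \<in> RM p n D" for i Q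
      proof -
        have "card (insert Q S) \<le> m + 1" using S(2) finS by (simp add: card_insert_if)
        moreover have "insert Q S \<subseteq> RM p n D" using S(1) that(2) by blast
        ultimately show ?thesis using C0[OF that(1)] p \<phi> unfolding approximable_def by blast
      qed
      then obtain \<F> where \<F>0: "\<And>i Q. i \<in> I \<Longrightarrow> Q \<in> RM p n D \<Longrightarrow>
        approximating_family p n D (M' i) (s + 1) c0 (insert Q S) \<phi> (\<F> i Q)" by metis
      have \<F>: "finite (\<F> i Q)" "card (\<F> i Q) \<le> p ^ c0"
        "\<And>H. H \<in> \<F> i Q \<Longrightarrow> H \<subseteq> RM p n D \<and> card H \<le> c0"
        "\<And>f W. image_mset snd W = M' i \<Longrightarrow> typed p n W \<Longrightarrow>
            determined p n (insert Q S \<union> fst ` set_mset W) f \<Longrightarrow>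
            \<exists>H\<in>\<F> i Q. \<bar>discrepancy p n \<phi> H f\<bar> \<le> 1 / real p ^ (s + 1)"
        if "i \<in> I" "Q \<in> RM p n D" for i Q
        using \<F>0[OF that] unfolding approximating_family_def by blast+
      have LD: "Q \<in> RM p n D" if "y \<in> GFp p" "i \<in> I" "Q \<in> L y u (fst i)" for y u i Q
      proof -
        have "fst i \<le> D" using that(2) 1(2) by (auto simp: I_def)
        then show ?thesis using L(1)[OF that(1)] that(3) RM_mono by blast
      qed
      let ?U = "S \<rightarrow>\<^sub>E GFp p"
      define \<G>' where "\<G>' = (\<Union>y\<in>GFp p. \<Union>u\<in>?U. \<Union>i\<in>I. \<Union>Q\<in>L y u (fst i). \<F> i Q)"
      have finL: "finite (L y u e)" if "y \<in> GFp p" for y u e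
        using L(1)[OF that] finite_RM finite_subset by blast
      have finU: "finite ?U" using finS by (intro finite_PiE) (simp_all add: finite_GFp)
      have cU: "card ?U \<le> p ^ m" using finS S(2) p0 by (simp add: card_PiE card_GFp power_increasing)
      \<comment> \<open>A bounded number of outcomes is paid for by a power of p, through card I
        \<le> 2 ^ card I.\<close>
      have cI: "card I \<le> p ^ card I"
        by (meson less_exp less_imp_le order_trans p2 power_mono zero_le)
      have fin\<G>': "finite \<G>'" unfolding \<G>'_def
        using finite_GFp finU finI finL LD \<F>(1) by (intro finite_UN_I) blast+
      define N where "N = p ^ (1 + (m + (card I + (r + c0))))"
      have "card \<G>' \<le> N"
        unfolding \<G>'_def N_def
        using finite_GFp finU finI finL LD \<F>(1,2) L(2) cU cI
        by (intro card_UN_power finite_UN_I) (auto simp: card_GFp)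
      moreover have "1 \<le> N" using p0 by (simp add: N_def)
      moreover have "card (insert S \<G>') \<le> Suc (card \<G>')" using fin\<G>' by (simp add: card_insert_if)
      ultimately have "card (insert S \<G>') \<le> 2 * N" by linarith
      also have "\<dots> \<le> p * N" using p2 by (rule mult_right_mono) simp
      finally have card\<G>: "card (insert S \<G>') \<le> p ^ c" by (simp add: c_def N_def)
      have sub: "H \<subseteq> RM p n D \<and> card H \<le> c" if "H \<in> insert S \<G>'" for H
      proof (cases "H = S")
        case True
        then show ?thesis using S by (simp add: c_def)
      next
        case False
        then have "H \<subseteq> RM p n D \<and> card H \<le> c0"
          using that LD \<F>(3) unfolding \<G>'_def by blast
        then show ?thesis by (simp add: c_def)
      qed
      have approx: "\<exists>H\<in>insert S \<G>'. \<bar>discrepancy p n \<phi> H f\<bar> \<le> 1 / real p ^ s"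
        if W: "image_mset snd W = M" "typed p n W" and f: "determined p n (S \<union> fst ` set_mset W) f" for f W
      proof (cases "\<bar>discrepancy p n \<phi> S f\<bar> \<le> 1 / real p ^ s")
        case True
        then show ?thesis by blast
      next
        case large: False
        let ?T = "fst ` set_mset W"
        have range: "\<forall>h\<in>S \<union> ?T. \<forall>x\<in>points p n. h x \<in> GFp p"
          using S(1) W(2) RM_range by (fastforce simp: typed_def)
        have "card ?T \<le> size M"
        proof -
          have "card ?T \<le> card (set_mset W)" by (rule card_image_le) simp
          also have "\<dots> \<le> size W" by (rule card_set_mset_le_size)
          also have "\<dots> = size M" using W(1) by auto
          finally show ?thesis .
        qed
        then have cardST: "card S + card ?T \<le> m + size M" using S(2) by simp
        have large': "1 / real p ^ s < \<bar>discrepancy p n \<phi> S f\<bar>" using large by simp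
        have finT: "finite ?T" by simp
        define nontrivial where "nontrivial b \<longleftrightarrow> (\<exists>g\<in>?T. \<not> int p dvd b g)" for b
        define corr where
          "corr y u b = cmod (\<Sum>x\<in>points p n. w y u x * character p (\<Sum>g\<in>?T. b g * g x))" for y u b
        have "\<exists>y\<in>GFp p. \<exists>u\<in>?U. \<exists>b. nontrivial b \<and> real (p ^ n) / real p ^ K \<le> corr y u b"
          unfolding nontrivial_def corr_def w_def K_def
          by (rule correlating_combination[where \<phi> = \<phi> and n = n, OF p \<phi>' finS finT cardST range f large'])
        then obtain y u b where yu: "y \<in> GFp p" "u \<in> ?U"
          and "nontrivial b" "real (p ^ n) / real p ^ K \<le> corr y u b" by blast
        then have b: "\<exists>g\<in>?T. \<not> int p dvd b g"
          "real (p ^ n) / real p ^ K \<le> cmod (\<Sum>x\<in>points p n. w y u x * character p (\<Sum>g\<in>?T. b g * g x))"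
          by (simp_all only: nontrivial_def corr_def)
        define P where "P = (\<lambda>x\<in>points p n. (\<Sum>h\<in>?T. b h * h x) mod int p)"
        obtain g e where g: "(g, e) \<in># W" "\<not> int p dvd b g" and P: "P \<in> RM p n e"
          using exists_leading_polynomial[OF p0 W(2) b(1)] unfolding P_def by blast
        have eM: "e \<in># M" using g(1) W(1) by force
        then have e1: "e \<ge> 1" using False by (metis One_nat_def Suc_leI gr0I)
        have "(\<Sum>x\<in>points p n. w y u x * character p (P x))
          = (\<Sum>x\<in>points p n. w y u x * character p (\<Sum>g\<in>?T. b g * g x))"
          by (rule sum.cong) (simp_all add: P_def character_mod[OF p0])
        then obtain Q where Q: "Q \<in> L y u e"
          "real (p ^ n) / real p ^ r \<le> cmod (\<Sum>x\<in>points p n. character p (P x - Q x))"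
          using L(3)[OF yu(1) P, of u] b(2) by auto
        have QR: "Q \<in> RM p n e" using L(1)[OF yu(1)] Q(1) by blast
        obtain W' f' l B where W': "typed p n W'" "l < Suc e ^ (2 * r + (s + 2) + 8)"
          "image_mset snd W' = M - {#e#} + replicate_mset l (e - 1)"
          and f': "determined p n (insert Q S \<union> fst ` set_mset W') f'"
          and B: "B \<subseteq> points p n" "real (card B) \<le> real (p ^ n) / real p ^ (s + 2)"
            "\<And>x. x \<in> points p n - B \<Longrightarrow> f x = f' x"
          using trade_polynomial[OF p W(2) f g e1 P_def P QR Q(2), of "s + 2"] W(1) by auto
        have i: "(e, l) \<in> I" using eM W'(2) by (simp add: I_def)
        have QD: "Q \<in> RM p n D" using LD[OF yu(1) i] Q(1) by simp
        obtain H where H: "H \<in> \<F> (e, l) Q" "\<bar>discrepancy p n \<phi> H f'\<bar> \<le> 1 / real p ^ (s + 1)"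
          using \<F>(4)[OF i QD _ W'(1) f'] W'(3) by (auto simp: M'_def)
        have "\<bar>discrepancy p n \<phi> H f\<bar> \<le> \<bar>discrepancy p n \<phi> H f'\<bar> + 2 / real p ^ (s + 2)"
          by (rule discrepancy_perturb[where \<phi> = \<phi> and n = n, OF p0 \<phi>' B])
        also have "\<dots> \<le> 1 / real p ^ (s + 1) + 2 / real p ^ (s + 2)" using H(2) by simp
        \<comment> \<open>The exponents s + 1 and s + 2 were chosen so that p + 2 \<le> 2 p \<le>
          p^2 absorbs both errors for every prime, including 2.\<close>
        also have "\<dots> = (real p + 2) / real p ^ (s + 2)"
          using p0 by (simp add: field_simps)
        also have "\<dots> \<le> (real p * real p) / real p ^ (s + 2)"
        proof (rule divide_right_mono)
          have "2 * real p \<le> real p * real p" using p2 by (intro mult_right_mono) auto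
          then show "real p + 2 \<le> real p * real p" using p2 by linarith
        qed simp
        also have "\<dots> = 1 / real p ^ s" using p0 by (simp add: power_add)
        finally have "\<bar>discrepancy p n \<phi> H f\<bar> \<le> 1 / real p ^ s" .
        moreover have "H \<in> \<G>'" unfolding \<G>'_def using yu i Q(1) H(1) by force
        ultimately show ?thesis by blast
      qed
      show "\<exists>\<G>. approximating_family p n D M s c S \<phi> \<G>"
        unfolding approximating_family_def
        using fin\<G>' card\<G> sub approx by (intro exI[of _ "insert S \<G>'"]) blast
    qed
    then show ?thesis by blast
  qed
qed

text \<open>The map \<Gamma> matters only through what it makes f depend on. The additional
  polynomials are recorded with their index i as degree, repetitions included, so i occurs k i times
  and the multiset of degrees is fixed by d and k alone.\<close>

lemma RM_struct_determined:
  assumes "f \<in> RM_struct p n d k Fs"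
  shows "\<exists>W. image_mset snd W = image_mset fst (mset_set (SIGMA i:{1..d - 1}. {..<k i})) \<and>
    typed p n W \<and> determined p n (Fs \<union> fst ` set_mset W) f"
proof -
  let ?J = "SIGMA i:{1..d - 1}. {..<k i}"
  obtain g :: "nat \<Rightarrow> nat \<Rightarrow> pfun" and \<Gamma> :: "(pfun \<Rightarrow> int) \<Rightarrow> (nat \<Rightarrow> nat \<Rightarrow> int) \<Rightarrow> int"
    where g: "\<And>i j. i \<in> {1..d - 1} \<Longrightarrow> j < k i \<Longrightarrow> g i j \<in> RM p n i"
      and \<Gamma>: "\<And>x. x \<in> points p n \<Longrightarrow>
          f x = \<Gamma> (\<lambda>h\<in>Fs. h x) (\<lambda>i\<in>{1..d - 1}. \<lambda>j\<in>{..<k i}. g i j x)"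
    using assms unfolding RM_struct_def by blast
  define W where "W = image_mset (\<lambda>(i, j). (g i j, i)) (mset_set ?J)"
  have setW: "set_mset W = (\<lambda>(i, j). (g i j, i)) ` ?J" by (simp add: W_def)
  have "image_mset snd W = image_mset fst (mset_set ?J)"
    by (simp add: W_def multiset.map_comp comp_def case_prod_unfold)
  moreover have "typed p n W" using g by (auto simp: typed_def setW)
  moreover have "determined p n (Fs \<union> fst ` set_mset W) f"
    unfolding determined_def
  proof (intro ballI impI)
    fix x z assume xz: "x \<in> points p n" "z \<in> points p n" "agree (Fs \<union> fst ` set_mset W) x z"
    have "(\<lambda>h\<in>Fs. h x) = (\<lambda>h\<in>Fs. h z)" using xz(3) by (intro restrict_ext) (simp add: agree_def)
    moreover have "g i j x = g i j z" if "i \<in> {1..d - 1}" "j < k i" for i j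
    proof -
      have "(g i j, i) \<in> set_mset W" unfolding setW using that by force
      then have "g i j \<in> fst ` set_mset W" by (rule image_eqI[rotated]) simp
      then show ?thesis using xz(3) unfolding agree_def by blast
    qed
    then have "(\<lambda>i\<in>{1..d - 1}. \<lambda>j\<in>{..<k i}. g i j x) = (\<lambda>i\<in>{1..d - 1}. \<lambda>j\<in>{..<k i}. g i j z)"
      by (intro restrict_ext) simp
    ultimately show "f x = f z" using \<Gamma> xz(1,2) by simp
  qed
  ultimately show ?thesis by blast
qed

theorem theorem6p6:
  fixes d s m :: nat and k :: "nat \<Rightarrow> nat"
  assumes "1 \<le> d"
  shows "\<exists>c :: nat. \<forall>p n :: nat. prime p \<longrightarrow>
    (\<forall>Fs. Fs \<subseteq> RM p n (d - 1) \<and> card Fs = m \<longrightarrow>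
      (\<forall>\<phi>. (\<forall>x\<in>points p n. \<phi> x \<in> prob_simplex p) \<longrightarrow>
        (\<exists>G :: nat \<Rightarrow> pfun set.
          (\<forall>i\<in>{1..p ^ c}. G i \<subseteq> RM p n (d - 1) \<and> card (G i) \<le> c) \<and>
          (\<forall>f\<in>RM_struct p n d k Fs. \<exists>i\<in>{1..p ^ c}.
            \<bar>avg_inner p n (unit_at f) \<phi> - avg_inner p n (unit_at f) (cond_avg p n \<phi> (G i))\<bar>
              \<le> 1 / real p ^ s))))"
proof -
  let ?M = "image_mset fst (mset_set (SIGMA i:{1..d - 1}. {..<k i}))"
  have "e \<le> d - 1" if "e \<in># ?M" for e using that by auto
  then obtain c where c: "approximable (d - 1) ?M s m c" using exists_approximable_constant by blast
  show ?thesis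
  proof (intro exI[of _ c] allI impI)
    fix p n Fs \<phi>
    assume p: "prime p" and Fs: "Fs \<subseteq> RM p n (d - 1) \<and> card Fs = m"
      and \<phi>: "\<forall>x\<in>points p n. \<phi> x \<in> prob_simplex p"
    have "card Fs \<le> m" using Fs by simp
    then obtain \<G> where "approximating_family p n (d - 1) ?M s c Fs \<phi> \<G>"
      using c p Fs \<phi> unfolding approximable_def by blast
    then have \<G>: "finite \<G>" "card \<G> \<le> p ^ c"
        "\<And>H. H \<in> \<G> \<Longrightarrow> H \<subseteq> RM p n (d - 1) \<and> card H \<le> c"
      and approx: "\<And>f W. image_mset snd W = ?M \<Longrightarrow> typed p n W \<Longrightarrow>
        determined p n (Fs \<union> fst ` set_mset W) f \<Longrightarrow> \<exists>H\<in>\<G>. \<bar>discrepancy p n \<phi> H f\<bar> \<le> 1 / real p ^ s"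
      unfolding approximating_family_def by blast+
    obtain h where h: "bij_betw h {1..card \<G>} \<G>"
      using ex_bij_betw_nat_finite_1[OF \<G>(1)] by blast
    \<comment> \<open>The family may have fewer than p^c members; the spare indices receive the
      empty set, which meets the degree and size conditions.\<close>
    define G where "G i = (if i \<in> {1..card \<G>} then h i else {})" for i
    have "G i \<subseteq> RM p n (d - 1) \<and> card (G i) \<le> c" for i
      using \<G>(3) bij_betwE[OF h] by (simp add: G_def)
    moreover have "\<exists>i\<in>{1..p ^ c}. \<bar>discrepancy p n \<phi> (G i) f\<bar> \<le> 1 / real p ^ s"
      if f: "f \<in> RM_struct p n d k Fs" for f
    proof -
      obtain H where H: "H \<in> \<G>" "\<bar>discrepancy p n \<phi> H f\<bar> \<le> 1 / real p ^ s"
        using RM_struct_determined[OF f] approx by blast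
      have "H \<in> h ` {1..card \<G>}" using H(1) bij_betw_imp_surj_on[OF h] by simp
      then obtain i where i: "H = h i" "i \<in> {1..card \<G>}" by (rule imageE)
      then have "G i = H" by (simp add: G_def)
      moreover have "i \<in> {1..p ^ c}" using i(2) \<G>(2) by simp
      ultimately show ?thesis using H(2) by blast
    qed
    ultimately have "(\<forall>i\<in>{1..p ^ c}. G i \<subseteq> RM p n (d - 1) \<and> card (G i) \<le> c) \<and>
      (\<forall>f\<in>RM_struct p n d k Fs. \<exists>i\<in>{1..p ^ c}. \<bar>discrepancy p n \<phi> (G i) f\<bar> \<le> 1 / real p ^ s)"
      by blast
    then show "\<exists>G. (\<forall>i\<in>{1..p ^ c}. G i \<subseteq> RM p n (d - 1) \<and> card (G i) \<le> c) \<and>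
          (\<forall>f\<in>RM_struct p n d k Fs. \<exists>i\<in>{1..p ^ c}.
            \<bar>avg_inner p n (unit_at f) \<phi> - avg_inner p n (unit_at f) (cond_avg p n \<phi> (G i))\<bar>
              \<le> 1 / real p ^ s)"
      unfolding discrepancy_def by (rule exI[of _ G])
  qed
qed

end
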